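(* Let $U\in\mathrm{U}(2d,\mathbb{C})$ be such that $U^tU$ is not $d\times d$ block-diagonal, and let $\mathbf{A}=\mathcal{R}_U\in\mathrm{Sp}(4d,\mathbb{R})$. Let $\Omega=\Omega(\mathbf{A})\in\mathrm{GL}(2d,\mathbb{R})$ be a matrix which, together with some index $1\le k\le d$ and some symplectic matrices $\mathcal{A},\mathcal{B}\in\mathrm{Sp}(2d,\mathbb{R})$, gives the factorization $$|W_{\mathbf{A}}(u,v)| = |\widehat{\mathcal{D}_\Omega}\, V^k_{\widehat{\mathcal{B}} v}\,\widehat{\mathcal{A}}u| \quad\text{for all } u,v\in L^2(\mathbb{R}^d).$$ If $f,g\in L^2(\mathbb{R}^d)$ satisfy $$\int_{\mathbb{R}^{2d}} |W_{\mathbf{A}}(f,g)(\lambda)|\, \exp\left(\frac{\pi}{2}\left|\Omega^{-1}\lambda\cdot \begin{pmatrix}0&I_d\\ I_d&0\end{pmatrix}\Omega^{-1}\lambda\right|\right) d\lambda<\infty,$$ then $f\equiv 0$ or $g\equiv 0$.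
   Context: Functions in $L^2$ are identified when equal a.e. ($f\equiv0$ means zero a.e.). $\mathrm{Sp}(2n,\mathbb{R})=\{M\in\mathbb{R}^{2n\times 2n}: M^t\mathcal{J}M=\mathcal{J}\}$, $\mathcal{J}=\begin{pmatrix}0&I\\-I&0\end{pmatrix}$. For $(x,\omega)\in\mathbb{R}^n\times\mathbb{R}^n$, $\rho(x,\omega)f(t)=e^{-\pi i x\cdot\omega}e^{2\pi i\omega\cdot t}f(t-x)$. For $M\in\mathrm{Sp}(2n,\mathbb{R})$, $\widehat{M}$ denotes an associated metaplectic operator: a unitary operator on $L^2(\mathbb{R}^n)$ with $\rho(M\lambda)=\widehat M\rho(\lambda)\widehat M^{-1}$ for all $\lambda\in\mathbb{R}^{2n}$; it is unique up to a factor of modulus 1 (irrelevant here, since only absolute values occur). For a unitary matrix $U=A+iB\in\mathrm{U}(n,\mathbb{C})$ with real part $A$ and imaginary part $B$, $\mathcal{R}_U=\begin{pmatrix}A&B\\-B&A\end{pmatrix}\in\mathrm{Sp}(2n,\mathbb{R})$. For $L\in\mathrm{GL}(n,\mathbb{R})$, $\widehat{\mathcal{D}_L}F(x)=|\det L|^{-1/2}F(L^{-1}x)$. For $\mathbf{A}\in\mathrm{Sp}(4d,\mathbb{R})$, $\widehat{\mathbf{A}}$ acts on $L^2(\mathbb{R}^{2d})$, and the metaplectic time-frequency representation is $W_{\mathbf{A}}(f,g)=\widehat{\mathbf{A}}(f\otimes\overline g)$ for $f,g\in L^2(\mathbb{R}^d)$, where $(f\otimes \overline g)(x,y)=f(x)\overline{g(y)}$.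 A $2d\times2d$ matrix is called $d\times d$ block-diagonal if it has the form $\begin{pmatrix}U_1&0\\0&U_2\end{pmatrix}$ with $U_1,U_2$ of size $d\times d$. $U^t$ is the transpose (no conjugation). Partial short-time Fourier transform: for $1\le k\le d$ and $f,g\in L^2(\mathbb{R}^d)$, $$V^k_gf(x_1,x_2,\omega_1,\omega_2)=\int_{\mathbb{R}^k}f(t,x_2)\overline{g(t-x_1,-\omega_2)}e^{-2\pi i t\cdot\omega_1}\,dt,$$ for $(x_1,x_2,\omega_1,\omega_2)\in\mathbb{R}^k\times\mathbb{R}^{d-k}\times\mathbb{R}^k\times\mathbb{R}^{d-k}$ (defined for almost all $(x_2,\omega_2)$); for $k=d$ this is the usual short-time Fourier transform. It is known that when $U^tU$ is not $d\times d$ block-diagonal, data $k,\mathcal{A},\mathcal{B},\Omega$ giving the factorization in the claim exist. *)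

theory Defs
  imports "HOL-Analysis.Analysis"
begin

text \<open>
  \<open>\<real>\<^sup>n\<close> is rendered as \<open>real ^ 'n\<close>. A vector of \<open>\<real>\<^sup>2\<^sup>n\<close> is indexed by the sum type
  \<open>'n + 'n\<close>: the entries \<open>Inl i\<close> are the first \<open>n\<close> coordinates, the entries \<open>Inr i\<close> the last \<open>n\<close>.
\<close>

definition fst_half :: "'a ^ ('n::finite + 'n) \<Rightarrow> 'a ^ 'n" where
  "fst_half z = (\<chi> i. z $ Inl i)"

definition snd_half :: "'a ^ ('n::finite + 'n) \<Rightarrow> 'a ^ 'n" where
  "snd_half z = (\<chi> i. z $ Inr i)"

definition block_mat ::
    "'a ^ 'n ^ 'n \<Rightarrow> 'a ^ 'n ^ 'n \<Rightarrow> 'a ^ 'n ^ 'n \<Rightarrow> 'a ^ 'n ^ 'n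
      \<Rightarrow> 'a ^ ('n::finite + 'n) ^ ('n + 'n)" where
  "block_mat A B C D = (\<chi> i j. case i of
      Inl a \<Rightarrow> (case j of Inl b \<Rightarrow> A $ a $ b | Inr b \<Rightarrow> B $ a $ b)
    | Inr a \<Rightarrow> (case j of Inl b \<Rightarrow> C $ a $ b | Inr b \<Rightarrow> D $ a $ b))"

definition block_diagonal :: "'a::zero ^ ('n::finite + 'n) ^ ('n + 'n) \<Rightarrow> bool" where
  "block_diagonal M \<longleftrightarrow> (\<exists>M1 M2. M = block_mat M1 0 0 M2)"


subsection \<open>Symplectic and unitary matrices\<close>

definition sympl_J :: "real ^ ('n::finite + 'n) ^ ('n + 'n)" where
  "sympl_J = block_mat 0 (mat 1) (- mat 1) 0"

definition Sp :: "(real ^ ('n::finite + 'n) ^ ('n + 'n)) set" where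
  "Sp = {M. transpose M ** sympl_J ** M = sympl_J}"

definition conj_transpose :: "complex ^ 'n ^ 'm \<Rightarrow> complex ^ 'm ^ 'n" where
  "conj_transpose U = (\<chi> i j. cnj (U $ j $ i))"

definition unitary_matrix :: "complex ^ 'n::finite ^ 'n \<Rightarrow> bool" where
  "unitary_matrix U \<longleftrightarrow> conj_transpose U ** U = mat 1 \<and> U ** conj_transpose U = mat 1"

definition Re_mat :: "complex ^ 'n ^ 'm \<Rightarrow> real ^ 'n ^ 'm" where
  "Re_mat U = (\<chi> i j. Re (U $ i $ j))"

definition Im_mat :: "complex ^ 'n ^ 'm \<Rightarrow> real ^ 'n ^ 'm" where
  "Im_mat U = (\<chi> i j. Im (U $ i $ j))"

definition rot_mat :: "complex ^ 'n::finite ^ 'n \<Rightarrow> real ^ ('n + 'n) ^ ('n + 'n)" where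
  "rot_mat U = block_mat (Re_mat U) (Im_mat U) (- Im_mat U) (Re_mat U)"

lemma block_mat_mult:
  fixes A B C D A' B' C' D' :: "'a::semiring_1 ^ 'n::finite ^ 'n"
  shows "block_mat A B C D ** block_mat A' B' C' D' =
    block_mat (A ** A' + B ** C') (A ** B' + B ** D') (C ** A' + D ** C') (C ** B' + D ** D')"
proof -
  have sum_split: "sum h UNIV = (\<Sum>i\<in>UNIV. h (Inl i)) + (\<Sum>i\<in>UNIV. h (Inr i))"
    for h :: "'n + 'n \<Rightarrow> 'a"
    by (subst UNIV_Plus_UNIV [symmetric], subst sum.Plus) auto
  show ?thesis
    unfolding vec_eq_iff block_mat_def matrix_matrix_mult_def
    by (auto simp: sum_split split: sum.split)
qed

lemma transpose_block_mat:
  "transpose (block_mat A B C D) =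
    block_mat (transpose A) (transpose C) (transpose B) (transpose D)"
  unfolding vec_eq_iff transpose_def block_mat_def by (auto split: sum.split)

lemma rot_mat_in_Sp:
  fixes U :: "complex ^ 'n::finite ^ 'n"
  assumes "unitary_matrix U"
  shows "rot_mat U \<in> Sp"
proof -
  let ?A = "Re_mat U" and ?B = "Im_mat U"
  have eq: "conj_transpose U ** U = mat 1"
    using assms by (simp add: unitary_matrix_def)
  have e: "(\<Sum>k\<in>UNIV. cnj (U $ k $ i) * U $ k $ j) = (if i = j then 1 else 0)" for i j
    using arg_cong [OF eq, of "\<lambda>M. M $ i $ j"]
    by (simp add: matrix_matrix_mult_def conj_transpose_def mat_def)
  have re: "transpose ?A ** ?A + transpose ?B ** ?B = mat 1"
  proof -
    have "(\<Sum>k\<in>UNIV. Re (U $ k $ i) * Re (U $ k $ j)) + (\<Sum>k\<in>UNIV. Im (U $ k $ i) * Im (U $ k $ j))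
        = (if i = j then 1 else 0)" for i j
      using arg_cong [OF e [of i j], of Re] by (simp add: sum.distrib)
    then show ?thesis
      by (simp add: vec_eq_iff matrix_matrix_mult_def transpose_def mat_def Re_mat_def Im_mat_def)
  qed
  have im: "transpose ?A ** ?B = transpose ?B ** ?A"
  proof -
    have "(\<Sum>k\<in>UNIV. Re (U $ k $ i) * Im (U $ k $ j)) = (\<Sum>k\<in>UNIV. Im (U $ k $ i) * Re (U $ k $ j))"
      for i j
      using arg_cong [OF e [of i j], of Im]
      by (simp add: sum_subtractf split: if_splits)
    then show ?thesis
      by (simp add: vec_eq_iff matrix_matrix_mult_def transpose_def Re_mat_def Im_mat_def)
  qed
  have neg_left: "(- X) ** Y = - (X ** Y)" and neg_right: "X ** (- Y) = - (X ** Y)"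
    and zero_left: "0 ** Y = 0" and zero_right: "X ** 0 = 0"
    and neg_transpose: "transpose (- X) = - transpose X"
    for X Y :: "real ^ 'n ^ 'n"
    by (simp_all add: vec_eq_iff matrix_matrix_mult_def transpose_def sum_negf)
  have re': "- (transpose ?B ** ?B) - transpose ?A ** ?A = - mat 1"
    using re by (metis add.commute diff_conv_add_uminus minus_add_distrib)
  show ?thesis
    unfolding Sp_def rot_mat_def sympl_J_def
    using re re' im
    by (simp add: transpose_block_mat block_mat_mult neg_left neg_right zero_left zero_right
        neg_transpose add.commute)
qed


subsection \<open>The space of square-integrable functions and its unitary operators\<close>

text \<open>
  Elements of \<open>L\<^sup>2\<close> are given by Borel representatives (every class has one), and
  the identification of functions is the explicit relation \<open>\<approx>\<close>. Consequently an operator on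
  \<open>L\<^sup>2\<close> is a map on representatives that respects \<open>\<approx>\<close>, and its algebraic properties hold up
  to \<open>\<approx>\<close>. Values outside \<open>L2\<close> are irrelevant.
\<close>

definition L2 :: "(real ^ 'n::finite \<Rightarrow> complex) set" where
  "L2 = {f. f \<in> borel_measurable lborel \<and> integrable lborel (\<lambda>x. (norm (f x))\<^sup>2)}"

definition ae_eq :: "(real ^ 'n::finite \<Rightarrow> complex) \<Rightarrow> (real ^ 'n \<Rightarrow> complex) \<Rightarrow> bool"
    (infix "\<approx>" 50) where
  "f \<approx> g \<longleftrightarrow> (AE x in lborel. f x = g x)"

definition L2_inner :: "(real ^ 'n::finite \<Rightarrow> complex) \<Rightarrow> (real ^ 'n \<Rightarrow> complex) \<Rightarrow> complex" where
  "L2_inner f g = (LINT x|lborel. f x * cnj (g x))"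

definition unitary_operator ::
    "((real ^ 'n::finite \<Rightarrow> complex) \<Rightarrow> (real ^ 'n \<Rightarrow> complex)) \<Rightarrow> bool" where
  "unitary_operator T \<longleftrightarrow>
     (\<forall>f\<in>L2. T f \<in> L2) \<and>
     (\<forall>f\<in>L2. \<forall>g\<in>L2. f \<approx> g \<longrightarrow> T f \<approx> T g) \<and>
     (\<forall>f\<in>L2. \<forall>g\<in>L2. \<forall>a b. T (\<lambda>x. a * f x + b * g x) \<approx> (\<lambda>x. a * T f x + b * T g x)) \<and>
     (\<forall>f\<in>L2. \<forall>g\<in>L2. L2_inner (T f) (T g) = L2_inner f g) \<and>
     (\<forall>g\<in>L2. \<exists>f\<in>L2. T f \<approx> g)"


subsection \<open>Time-frequency shifts and metaplectic operators\<close>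

definition tf_shift ::
    "real ^ ('n::finite + 'n) \<Rightarrow> (real ^ 'n \<Rightarrow> complex) \<Rightarrow> (real ^ 'n \<Rightarrow> complex)" where
  "tf_shift l f = (\<lambda>t. cis (- pi * (fst_half l \<bullet> snd_half l)) * cis (2 * pi * (snd_half l \<bullet> t))
     * f (t - fst_half l))"

text \<open>
  The condition \<open>\<rho>(M\<lambda>) = T \<rho>(\<lambda>) T\<^sup>-\<^sup>1\<close> is written as \<open>\<rho>(M\<lambda>) T = T \<rho>(\<lambda>)\<close>, because \<open>T\<close> is
  invertible only up to \<open>\<approx>\<close> as a map on representatives. The notion is meant for \<open>M \<in> Sp\<close>;
  it determines \<open>T\<close> only up to a factor of modulus one, hence it is a predicate on \<open>T\<close>.
\<close>

definition metaplectic ::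
    "real ^ ('n::finite + 'n) ^ ('n + 'n)
      \<Rightarrow> ((real ^ 'n \<Rightarrow> complex) \<Rightarrow> (real ^ 'n \<Rightarrow> complex)) \<Rightarrow> bool" where
  "metaplectic M T \<longleftrightarrow> unitary_operator T \<and>
     (\<forall>l. \<forall>f\<in>L2. tf_shift (M *v l) (T f) \<approx> T (tf_shift l f))"

definition dilation ::
    "real ^ 'n ^ 'n::finite \<Rightarrow> (real ^ 'n \<Rightarrow> complex) \<Rightarrow> (real ^ 'n \<Rightarrow> complex)" where
  "dilation L F = (\<lambda>x. of_real (\<bar>det L\<bar> powr (- 1 / 2)) * F (matrix_inv L *v x))"


subsection \<open>Time-frequency representations\<close>

definition tensor_conj ::
    "(real ^ 'd::finite \<Rightarrow> complex) \<Rightarrow> (real ^ 'd \<Rightarrow> complex) \<Rightarrow> (real ^ ('d + 'd) \<Rightarrow> complex)" where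
  "tensor_conj f g = (\<lambda>z. f (fst_half z) * cnj (g (snd_half z)))"

text \<open>The operator \<open>T\<close> below is a metaplectic operator attached to \<open>\<^bold>A \<in> Sp(4d,\<real>)\<close>.\<close>

definition metaplectic_tfr ::
    "((real ^ ('d::finite + 'd) \<Rightarrow> complex) \<Rightarrow> (real ^ ('d + 'd) \<Rightarrow> complex))
      \<Rightarrow> (real ^ 'd \<Rightarrow> complex) \<Rightarrow> (real ^ 'd \<Rightarrow> complex) \<Rightarrow> (real ^ ('d + 'd) \<Rightarrow> complex)" where
  "metaplectic_tfr T f g = T (tensor_conj f g)"

text \<open>
  The linear order on the index type \<open>'d\<close> only serves to say which are the first \<open>k\<close>
  coordinates. A point \<open>x \<in> \<real>\<^sup>d\<close> is split as \<open>(x\<^sub>1, x\<^sub>2)\<close> where \<open>x\<^sub>1\<close> consists of the entries with index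
  in \<open>first_coords k\<close>; the integration variable \<open>t \<in> \<real>\<^sup>k\<close> ranges over functions on
  \<open>first_coords k\<close>, with the product Lebesgue measure. For \<open>f, g \<in> L2\<close> the integral exists for almost all \<open>z\<close>.
\<close>

definition first_coords :: "nat \<Rightarrow> 'd::{finite,linorder} set" where
  "first_coords k = {i. card {j. j < i} < k}"

definition partial_STFT ::
    "nat \<Rightarrow> (real ^ 'd::{finite,linorder} \<Rightarrow> complex) \<Rightarrow> (real ^ 'd::{finite,linorder} \<Rightarrow> complex)
      \<Rightarrow> (real ^ ('d + 'd) \<Rightarrow> complex)" where
  "partial_STFT k g f = (\<lambda>z.
     let K = first_coords k; x = fst_half z; w = snd_half z in
     LINT t | Pi\<^sub>M K (\<lambda>_. lborel).
       f (\<chi> i. if i \<in> K then t i else x $ i)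
       * cnj (g (\<chi> i. if i \<in> K then t i - x $ i else - w $ i))
       * cis (- 2 * pi * (\<Sum>i\<in>K. t i * w $ i)))"

end

theory Submission
  imports Defs
    "HOL-Complex_Analysis.Conformal_Mappings"
    "HOL-Probability.Levy"
    "HOL-Real_Asymp.Real_Asymp"
begin

text \<open>
  The factorisation reduces the claim to a Beurling theorem for the partial short-time Fourier transform, and Fubini
  reduces this to the full short-time Fourier transform \<open>V\<close> of two square-integrable functions \<open>f\<close> and \<open>g\<close> on
  \<open>\<real>\<^sup>k\<close>: if \<open>\<bar>V (x, w)\<bar> exp (\<pi> \<bar>x \<bullet> w\<bar>)\<close> is integrable, then \<open>f = 0\<close> or \<open>g = 0\<close>. The slicing works because
  the weight for all coordinates is at least the weight for the first \<open>k\<close> coordinates times a constant that depends on the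
  remaining coordinates only.

  The theorem on \<open>\<real>\<^sup>k\<close> follows from the Bargmann transform. Integrating \<open>V\<close> against Gaussians with complex parameters
  gives, up to elementary factors, the product \<open>F \<zeta>' * G \<zeta>\<close> of the Bargmann transforms of \<open>f\<close> and of the conjugate of \<open>g\<close>
  (lemma \<open>STFT_Gaussian_integral_eq_bargmann\<close>). For \<open>\<zeta> = s \<eta>\<close> and \<open>\<zeta>' = \<plusminus>\<i> s \<eta>\<close>, with a complex
  number \<open>s\<close> and a real vector \<open>\<eta>\<close>, completing the square in the Gaussian produces the weight \<open>exp (\<pi> \<bar>x \<bullet> w\<bar>)\<close> and bounds the
  product by a constant times \<open>exp (\<pi>/2 \<bar>\<eta>\<bar>\<^sup>2 (Re s \<minusplus> Im s)\<^sup>2)\<close>. Therefore the entire function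
  \<open>Q s = F (\<i> s \<eta>) F (- \<i> s \<eta>) G (s \<eta>) G (- s \<eta>)\<close> is at most a constant times \<open>exp (\<pi> \<bar>\<eta>\<bar>\<^sup>2 (\<bar>Re s\<bar> - \<bar>Im s\<bar>)\<^sup>2)\<close>.

  A Phragmen--Lindelof argument in the four sectors between the diagonals
  (lemma \<open>bounded_if_bounded_near_diagonals\<close>) and Liouville's theorem make \<open>Q\<close> constant, and dominated convergence along a
  diagonal makes the constant zero. So one
  of the two Bargmann transforms vanishes on each complex line spanned by a real vector, hence one of them vanishes on
  all real vectors, and the uniqueness of the Fourier transform gives \<open>f = 0\<close> or \<open>g = 0\<close>.
\<close>


section \<open>Entire functions that are bounded near the diagonals\<close>

lemma maximum_modulus_rectangle:
  fixes h :: "complex \<Rightarrow> complex"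
  assumes hol: "h holomorphic_on UNIV"
    and horizontal: "\<And>x. \<lbrakk>\<bar>x\<bar> \<le> N\<rbrakk> \<Longrightarrow> norm (h (Complex x b)) \<le> B"
      "\<And>x. \<lbrakk>\<bar>x\<bar> \<le> N\<rbrakk> \<Longrightarrow> norm (h (Complex x (- b))) \<le> B"
    and vertical: "\<And>y. \<lbrakk>\<bar>y\<bar> \<le> b\<rbrakk> \<Longrightarrow> norm (h (Complex N y)) \<le> B"
      "\<And>y. \<lbrakk>\<bar>y\<bar> \<le> b\<rbrakk> \<Longrightarrow> norm (h (Complex (- N) y)) \<le> B"
    and z: "\<bar>Re z\<bar> \<le> N" "\<bar>Im z\<bar> \<le> b"
  shows "norm (h z) \<le> B"
proof (rule maximum_modulus_frontier[where f = h and S = "cbox (Complex (-N) (-b)) (Complex N b)"])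
  let ?S = "cbox (Complex (-N) (-b)) (Complex N b)"
  show "h holomorphic_on interior ?S"
    using hol holomorphic_on_subset by blast
  show "continuous_on (closure ?S) h"
    using hol holomorphic_on_imp_continuous_on continuous_on_subset by blast
  show "bounded ?S" by simp
  show "z \<in> ?S" using z by (auto simp: in_cbox_complex_iff)
  fix w assume "w \<in> frontier ?S"
  then have w: "w \<in> ?S" "w \<notin> box (Complex (-N) (-b)) (Complex N b)"
    by (auto simp: frontier_cbox)
  then have "\<bar>Re w\<bar> \<le> N" "\<bar>Im w\<bar> \<le> b"
    and "Re w = N \<or> Re w = - N \<or> Im w = b \<or> Im w = - b"
    by (force simp: in_cbox_complex_iff in_box_complex_iff)+
  then show "norm (h w) \<le> B"
    using horizontal[of "Re w"] vertical[of "Im w"]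
    by (metis complex_surj)
qed

lemma Re_Im_exp_diff:
  "(\<bar>Re (exp z)\<bar> - \<bar>Im (exp z)\<bar>)\<^sup>2 = exp (2 * Re z) * (1 - \<bar>sin (2 * Im z)\<bar>)"
proof -
  have e: "exp (2 * Re z) = exp (Re z) * exp (Re z)"
    by (simp add: exp_add[symmetric])
  have "(\<bar>Re (exp z)\<bar> - \<bar>Im (exp z)\<bar>)\<^sup>2 = (exp (Re z))\<^sup>2 * (\<bar>cos (Im z)\<bar> - \<bar>sin (Im z)\<bar>)\<^sup>2"
    by (simp add: Re_exp Im_exp abs_mult power_mult_distrib[symmetric] algebra_simps)
  also have "(\<bar>cos (Im z)\<bar> - \<bar>sin (Im z)\<bar>)\<^sup>2 = 1 - \<bar>sin (2 * Im z)\<bar>"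
    by (simp only: power2_diff sin_double abs_mult power2_abs) (simp add: algebra_simps)
  finally show ?thesis by (simp add: e power2_eq_square)
qed

text \<open>
  The variable \<open>exp \<zeta>\<close> turns the sector \<open>\<bar>arg\<bar> \<le> b\<close> into a strip, where truncation gives rectangles and no
  branch of a power is needed. The hypothesis says that \<open>Q\<close> is almost bounded close to the two
  diagonals, i.e. on the edges of the sector when \<open>b\<close> is close to \<open>\<pi>/4\<close>; the factor
  \<open>exp (- \<kappa> z\<^sup>2)\<close> repairs the small loss there. Since the sector is narrower than a quadrant, some power
  \<open>z\<^sup>p\<close> with \<open>p > 2\<close> still has positive real part in it, and \<open>exp (- \<delta> z\<^sup>p)\<close> beats growth of order two, so
  the Phragmen--Lindelof argument applies.
\<close>

lemma order_two_bound_in_sector: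
  fixes Q :: "complex \<Rightarrow> complex"
  assumes hol: "Q holomorphic_on UNIV" and C: "0 \<le> C" and c: "0 \<le> c"
    and bound: "\<And>z. norm (Q z) \<le> C * exp (c * (\<bar>Re z\<bar> - \<bar>Im z\<bar>)\<^sup>2)"
    and b: "0 < b" "b < pi / 4" and \<zeta>: "\<bar>Im \<zeta>\<bar> \<le> b"
  defines "\<kappa> \<equiv> c * (1 - sin (2 * b)) / cos (2 * b)"
  shows "norm (Q (exp \<zeta>)) \<le> C * exp (\<kappa> * Re (exp (2 * \<zeta>)))"
proof -
  \<comment> \<open>the midpoint of the interval \<open>(2, \<pi>/(2b))\<close> of admissible exponents\<close>
  define p where "p = (2 + pi / (2 * b)) / 2"
  have p: "2 < p" "p * b < pi / 2"
    using b by (auto simp: p_def field_simps)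
  have pb: "p * b < pi" using p pi_gt_zero by linarith
  have c2b: "0 < cos (2 * b)" and s2b: "sin (2 * b) \<le> 1" "0 < sin (2 * b)"
    using b by (auto intro!: cos_gt_zero_pi sin_gt_zero)
  have cpb: "0 < cos (p * b)"
    using b p by (intro cos_gt_zero_pi) (auto intro: order_less_le_trans[of _ 0] mult_pos_pos)
  have \<kappa>: "0 \<le> \<kappa>" "\<kappa> * cos (2 * b) = c * (1 - sin (2 * b))"
    using c c2b s2b by (auto simp: \<kappa>_def)
  have cosmono: "cos (q * b) \<le> cos (q * y)" if "\<bar>y\<bar> \<le> b" "0 < q" "q * b < pi" for y q
  proof -
    have "cos (q * b) \<le> cos \<bar>q * y\<bar>"
      using that b by (subst cos_mono_le_eq) (auto simp: abs_mult mult_left_mono intro: order_trans[of _ "q * b"])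
    then show ?thesis by simp
  qed
  have main: "norm (Q (exp \<zeta>)) \<le> C * exp (\<kappa> * Re (exp (2 * \<zeta>)) + \<delta> * Re (exp (of_real p * \<zeta>)))"
    if \<delta>: "\<delta> > 0" for \<delta>
  proof -
    define h where "h = (\<lambda>z. Q (exp z) * exp (- of_real \<kappa> * exp (2 * z) - of_real \<delta> * exp (of_real p * z)))"
    have hol_h: "h holomorphic_on UNIV"
      unfolding h_def
      by (intro holomorphic_intros holomorphic_on_compose_gen[OF _ hol, unfolded o_def]) auto
    have norm_h: "norm (h z) = norm (Q (exp z)) * exp (- \<kappa> * (exp (2 * Re z) * cos (2 * Im z))
        - \<delta> * (exp (p * Re z) * cos (p * Im z)))" for z
      by (simp add: h_def norm_mult norm_exp_eq_Re Re_exp)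
    have norm_h_le: "norm (h z) \<le> C * exp (c * (exp (2 * Re z) * (1 - \<bar>sin (2 * Im z)\<bar>))
        - \<kappa> * (exp (2 * Re z) * cos (2 * Im z)) - \<delta> * (exp (p * Re z) * cos (p * Im z)))" for z
    proof -
      have "norm (h z) \<le> C * exp (c * (\<bar>Re (exp z)\<bar> - \<bar>Im (exp z)\<bar>)\<^sup>2) * exp (- \<kappa> * (exp (2 * Re z) * cos (2 * Im z))
        - \<delta> * (exp (p * Re z) * cos (p * Im z)))"
        unfolding norm_h by (intro mult_right_mono bound) auto
      also have "\<dots> = C * exp (c * (exp (2 * Re z) * (1 - \<bar>sin (2 * Im z)\<bar>))
        - \<kappa> * (exp (2 * Re z) * cos (2 * Im z)) - \<delta> * (exp (p * Re z) * cos (p * Im z)))"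
        unfolding Re_Im_exp_diff mult.assoc exp_add[symmetric] by (simp add: algebra_simps)
      finally show ?thesis .
    qed
    have edge: "norm (h z) \<le> C" if "Im z = b \<or> Im z = - b" for z
    proof -
      have "\<bar>sin (2 * Im z)\<bar> = sin (2 * b)" "cos (2 * Im z) = cos (2 * b)" "cos (p * Im z) = cos (p * b)"
        using that s2b by auto
      then have "norm (h z) \<le> C * exp (exp (2 * Re z) * (c * (1 - sin (2 * b)) - \<kappa> * cos (2 * b))
          - \<delta> * (exp (p * Re z) * cos (p * b)))"
        using norm_h_le[of z] by (simp add: algebra_simps)
      also have "\<dots> \<le> C * 1"
        using \<delta> cpb unfolding \<kappa>(2) by (intro mult_left_mono C) auto
      finally show ?thesis by simp
    qed
    have inside: "norm (h z) \<le> C * exp (c * exp (2 * Re z) - \<delta> * cos (p * b) * exp (p * Re z))"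
      if y: "\<bar>Im z\<bar> \<le> b" for z
    proof -
      have 1: "c * (exp (2 * Re z) * (1 - \<bar>sin (2 * Im z)\<bar>)) \<le> c * (exp (2 * Re z) * 1)"
        by (intro mult_left_mono c) auto
      have 2: "0 \<le> \<kappa> * (exp (2 * Re z) * cos (2 * Im z))"
        using cosmono[OF y, of 2] b c2b \<kappa> by (intro mult_nonneg_nonneg) auto
      have 3: "\<delta> * (exp (p * Re z) * cos (p * b)) \<le> \<delta> * (exp (p * Re z) * cos (p * Im z))"
        using cosmono[OF y, of p] p \<delta> pb by (intro mult_left_mono) auto
      have "c * (exp (2 * Re z) * (1 - \<bar>sin (2 * Im z)\<bar>))
        - \<kappa> * (exp (2 * Re z) * cos (2 * Im z)) - \<delta> * (exp (p * Re z) * cos (p * Im z))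
        \<le> c * exp (2 * Re z) - \<delta> * cos (p * b) * exp (p * Re z)"
        using 1 2 3 by (simp add: algebra_simps)
      then show ?thesis
        using norm_h_le[of z] C by (smt (verit) exp_le_cancel_iff mult_left_mono)
    qed
    have "eventually (\<lambda>N. norm (h \<zeta>) \<le> C * exp (c * exp (- 2 * N))) at_top"
    proof -
      define d where "d = \<delta> * cos (p * b)"
      have "d > 0" using \<delta> cpb by (simp add: d_def)
      have "eventually (\<lambda>N. exp ((p - 2) * N) \<ge> c / d) at_top"
      proof -
        have "filterlim (\<lambda>N. (p - 2) * N) at_top at_top"
          using p by (intro filterlim_tendsto_pos_mult_at_top[OF tendsto_const] filterlim_ident) auto
        then have "filterlim (\<lambda>N. exp ((p - 2) * N)) at_top at_top"
          by (rule filterlim_compose[OF exp_at_top])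
        then show ?thesis by (simp add: filterlim_at_top)
      qed
      moreover have "eventually (\<lambda>N. N \<ge> \<bar>Re \<zeta>\<bar>) at_top"
        by (rule eventually_ge_at_top)
      ultimately show ?thesis
      proof eventually_elim
        fix N assume N: "exp ((p - 2) * N) \<ge> c / d" "N \<ge> \<bar>Re \<zeta>\<bar>"
        have "exp (p * N) = exp ((p - 2) * N) * exp (2 * N)"
          by (simp add: exp_add[symmetric] algebra_simps)
        moreover have "c \<le> d * exp ((p - 2) * N)"
          using N(1) \<open>d > 0\<close> by (simp add: field_simps)
        ultimately have right: "c * exp (2 * N) - d * exp (p * N) \<le> 0"
          by simp
        have ge1: "C \<le> C * exp (c * exp (- 2 * N))"
          using mult_left_mono[of 1 "exp (c * exp (- 2 * N))" C] C c by simp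
        show "norm (h \<zeta>) \<le> C * exp (c * exp (- 2 * N))"
        proof (rule maximum_modulus_rectangle[OF hol_h, of N b])
          have edge': "norm (h z) \<le> C * exp (c * exp (- 2 * N))" if "Im z = b \<or> Im z = - b" for z
            using edge[OF that] ge1 by linarith
          show "norm (h (Complex x b)) \<le> C * exp (c * exp (- 2 * N))" for x
            by (rule edge') simp
          show "norm (h (Complex x (- b))) \<le> C * exp (c * exp (- 2 * N))" for x
            by (rule edge') simp
          fix y assume y: "\<bar>y\<bar> \<le> b"
          have "norm (h (Complex N y)) \<le> C * exp (c * exp (2 * N) - d * exp (p * N))"
            using inside[of "Complex N y"] y by (simp add: d_def)
          also have "\<dots> \<le> C * 1" using right by (intro mult_left_mono C) auto
          finally show "norm (h (Complex N y)) \<le> C * exp (c * exp (- 2 * N))" using ge1 by simp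
          have "norm (h (Complex (- N) y)) \<le> C * exp (c * exp (- 2 * N) - d * exp (p * (- N)))"
            using inside[of "Complex (- N) y"] y by (simp add: d_def)
          also have "\<dots> \<le> C * exp (c * exp (- 2 * N))"
            using \<open>d > 0\<close> by (intro mult_left_mono C) auto
          finally show "norm (h (Complex (- N) y)) \<le> C * exp (c * exp (- 2 * N))" .
        qed (use N \<zeta> in auto)
      qed
    qed
    moreover have "((\<lambda>N. C * exp (c * exp (- 2 * N))) \<longlongrightarrow> C * exp (c * 0)) at_top"
    proof -
      have "filterlim (\<lambda>N::real. - 2 * N) at_bot at_top"
        by (intro filterlim_tendsto_neg_mult_at_bot[OF tendsto_const] filterlim_ident) auto
      then have "((\<lambda>N. exp (- 2 * N)) \<longlongrightarrow> (0::real)) at_top"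
        by (rule filterlim_compose[OF exp_at_bot])
      then show ?thesis by (intro tendsto_intros)
    qed
    ultimately have "norm (h \<zeta>) \<le> C * exp (c * 0)"
      by (intro tendsto_lowerbound[of _ _ at_top]) auto
    moreover have "norm (h \<zeta>) = norm (Q (exp \<zeta>)) * exp (- (\<kappa> * Re (exp (2 * \<zeta>)) + \<delta> * Re (exp (of_real p * \<zeta>))))"
      unfolding norm_h by (simp add: Re_exp)
    ultimately have "norm (Q (exp \<zeta>)) * exp (- (\<kappa> * Re (exp (2 * \<zeta>)) + \<delta> * Re (exp (of_real p * \<zeta>)))) \<le> C"
      by simp
    then show ?thesis
      by (simp only: exp_minus divide_inverse[symmetric] pos_divide_le_eq[OF exp_gt_zero])
  qed
  have "((\<lambda>\<delta>. C * exp (\<kappa> * Re (exp (2 * \<zeta>)) + \<delta> * Re (exp (of_real p * \<zeta>)))) \<longlongrightarrow>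
      C * exp (\<kappa> * Re (exp (2 * \<zeta>)) + 0 * Re (exp (of_real p * \<zeta>)))) (at_right 0)"
    by (intro tendsto_intros)
  moreover have "eventually (\<lambda>\<delta>::real. \<delta> > 0) (at_right 0)"
    by (simp add: eventually_at_right_less)
  ultimately have "norm (Q (exp \<zeta>)) \<le> C * exp (\<kappa> * Re (exp (2 * \<zeta>)) + 0 * Re (exp (of_real p * \<zeta>)))"
    using main by (intro tendsto_lowerbound[of _ _ "at_right 0"]) (auto elim!: eventually_mono)
  then show ?thesis by simp
qed

lemma abs_less_half_pi_if_cos_pos:
  fixes x :: real
  assumes "cos x > 0" "\<bar>x\<bar> < pi"
  shows "\<bar>x\<bar> < pi / 2"
proof (rule ccontr)
  assume "\<not> ?thesis"
  then have "cos \<bar>x\<bar> \<le> cos (pi / 2)"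
    using assms by (subst cos_mono_le_eq) auto
  with assms show False by simp
qed

text \<open>
  This is the critical case of the Phragmen--Lindelof principle: the order of growth is exactly the one
  that is borderline for a quadrant. It is still enough here because the bound holds everywhere,
  not only on the diagonals, so the sectors can be made slightly smaller than a quadrant; the price
  \<open>\<kappa> = c (1 - sin 2b) / cos 2b\<close> of doing so vanishes as \<open>b\<close> tends to \<open>\<pi>/4\<close>. The bound is invariant under multiplication of
  \<open>z\<close> by \<open>\<i>\<close>, which moves the other three sectors to the right one.
\<close>

lemma bounded_if_bounded_near_diagonals:
  fixes Q :: "complex \<Rightarrow> complex"
  assumes hol: "Q holomorphic_on UNIV" and C: "0 \<le> C" and c: "0 \<le> c"
    and bound: "\<And>z. norm (Q z) \<le> C * exp (c * (\<bar>Re z\<bar> - \<bar>Im z\<bar>)\<^sup>2)"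
  shows "norm (Q z) \<le> C"
proof -
  have right: "norm (Q w) \<le> C"
    if hol: "Q holomorphic_on UNIV" and bound: "\<And>z. norm (Q z) \<le> C * exp (c * (\<bar>Re z\<bar> - \<bar>Im z\<bar>)\<^sup>2)"
      and w: "\<bar>Im w\<bar> < Re w" for Q :: "complex \<Rightarrow> complex" and w
  proof -
    define \<zeta> where "\<zeta> = Ln w"
    have "w \<noteq> 0" using w by auto
    then have exp\<zeta>: "exp \<zeta> = w" by (simp add: \<zeta>_def)
    have sq: "(Im w)\<^sup>2 < (Re w)\<^sup>2"
      using w by (simp add: abs_le_square_iff[symmetric] linorder_not_le[symmetric])
    have Im\<zeta>: "\<bar>Im \<zeta>\<bar> < pi / 4"
    proof -
      have "\<bar>Im \<zeta>\<bar> < pi / 2" using Re_Ln_pos_lt[OF \<open>w \<noteq> 0\<close>] w unfolding \<zeta>_def by linarith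
      moreover have "cos (2 * Im \<zeta>) > 0"
      proof -
        have "Re (w\<^sup>2) = exp (2 * Re \<zeta>) * cos (2 * Im \<zeta>)"
          by (simp add: exp\<zeta>[symmetric] exp_double[symmetric] Re_exp)
        moreover have "Re (w\<^sup>2) > 0" using sq by (simp add: power2_eq_square)
        ultimately show ?thesis by (simp add: zero_less_mult_iff)
      qed
      ultimately show ?thesis
        using abs_less_half_pi_if_cos_pos[of "2 * Im \<zeta>"] unfolding abs_mult by simp
    qed
    have lim: "((\<lambda>b. C * exp (c * (1 - sin (2 * b)) / cos (2 * b) * Re (exp (2 * \<zeta>)))) \<longlongrightarrow> C * exp (c * 0 * Re (exp (2 * \<zeta>)))) (at_left (pi / 4))"
    proof -
      have "((\<lambda>b. cos (2 * b) / (1 + sin (2 * b))) \<longlongrightarrow> cos (2 * (pi/4)) / (1 + sin (2 * (pi/4)))) (at_left (pi / 4))"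
        by (intro tendsto_intros) auto
      then have "((\<lambda>b. cos (2 * b) / (1 + sin (2 * b))) \<longlongrightarrow> 0) (at_left (pi / 4))" by simp
      moreover have "eventually (\<lambda>b. b \<in> {0<..<pi/4}) (at_left (pi / 4))"
        by (rule eventually_at_leftI[of 0]) auto
      then have "eventually (\<lambda>b. cos (2 * b) / (1 + sin (2 * b)) = (1 - sin (2 * b)) / cos (2 * b)) (at_left (pi / 4))"
      proof eventually_elim
        case (elim b)
        then have "cos (2 * b) > 0" "sin (2 * b) > 0"
          by (auto intro!: cos_gt_zero_pi sin_gt_zero)
        then show ?case
          using sin_cos_squared_add[of "2 * b"] by (simp add: field_simps power2_eq_square)
      qed
      ultimately have "((\<lambda>b. (1 - sin (2 * b)) / cos (2 * b)) \<longlongrightarrow> 0) (at_left (pi / 4))"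
        using tendsto_cong by fast
      then have "((\<lambda>b. C * exp (c * ((1 - sin (2 * b)) / cos (2 * b)) * Re (exp (2 * \<zeta>)))) \<longlongrightarrow> C * exp (c * 0 * Re (exp (2 * \<zeta>)))) (at_left (pi / 4))"
        by (intro tendsto_intros)
      then show ?thesis by simp
    qed
    moreover have "eventually (\<lambda>b. b \<in> {\<bar>Im \<zeta>\<bar><..<pi/4}) (at_left (pi / 4))"
      using Im\<zeta> by (intro eventually_at_leftI[of "\<bar>Im \<zeta>\<bar>"]) auto
    then have "eventually (\<lambda>b. norm (Q w) \<le> C * exp (c * (1 - sin (2 * b)) / cos (2 * b) * Re (exp (2 * \<zeta>)))) (at_left (pi / 4))"
    proof eventually_elim
      case (elim b)
      then show ?case
        using order_two_bound_in_sector[OF hol C c bound, of b \<zeta>] by (auto simp: exp\<zeta>)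
    qed
    ultimately have "norm (Q w) \<le> C * exp (c * 0 * Re (exp (2 * \<zeta>)))"
      by (intro tendsto_lowerbound[of _ _ "at_left (pi / 4)"]) auto
    then show ?thesis by simp
  qed
  have rot: "norm (Q (u * w)) \<le> C" if "u \<in> {1, \<i>, -1, -\<i>}" "\<bar>Im w\<bar> < Re w" for u w
  proof (rule right[where Q = "\<lambda>w. Q (u * w)"])
    show "(\<lambda>w. Q (u * w)) holomorphic_on UNIV"
      by (intro holomorphic_on_compose_gen[OF _ hol, unfolded o_def] holomorphic_intros) auto
    show "norm (Q (u * z)) \<le> C * exp (c * (\<bar>Re z\<bar> - \<bar>Im z\<bar>)\<^sup>2)" for z
      using bound[of "u * z"] that(1) power2_commute[of "\<bar>Im z\<bar>" "\<bar>Re z\<bar>"] by auto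
  qed (use that in auto)
  consider "\<bar>Re z\<bar> = \<bar>Im z\<bar>" | "\<bar>Im z\<bar> < Re z" | "\<bar>Im z\<bar> < - Re z" | "\<bar>Re z\<bar> < Im z" | "\<bar>Re z\<bar> < - Im z"
    by linarith
  then show ?thesis
  proof cases
    case 1
    then show ?thesis using bound[of z] by simp
  next
    case 2
    then show ?thesis using rot[of 1 z] by simp
  next
    case 3
    then show ?thesis using rot[of "-1" "-z"] by simp
  next
    case 4
    then show ?thesis using rot[of "\<i>" "-\<i> * z"] by simp
  next
    case 5
    then show ?thesis using rot[of "-\<i>" "\<i> * z"] by simp
  qed
qed

lemma entire_mult_eq_zero:
  fixes a b :: "complex \<Rightarrow> complex"
  assumes a: "a holomorphic_on UNIV" and b: "b holomorphic_on UNIV" and ab: "\<And>z. a z * b z = 0"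
  shows "(\<forall>z. a z = 0) \<or> (\<forall>z. b z = 0)"
proof (rule ccontr)
  assume "\<not> ?thesis"
  then obtain z0 z1 where z0: "a z0 \<noteq> 0" and z1: "b z1 \<noteq> 0" by auto
  have "open {z. a z \<noteq> 0}"
    using holomorphic_on_imp_continuous_on[OF a] by (intro open_Collect_neq continuous_on_const)
  then have "b z1 = 0"
    by (rule analytic_continuation_open[where s = "{z. a z \<noteq> 0}" and s' = UNIV and f = b and g = "\<lambda>_. 0"])
      (use z0 ab b in auto)
  with z1 show False by simp
qed

lemma entire_zero_if_zero_on_reals:
  assumes "h holomorphic_on UNIV" "\<And>x::real. h (of_real x) = (0::complex)"
  shows "h s = 0"
proof (rule analytic_continuation[OF assms(1), of "range of_real" 0])
  show "(0::complex) islimpt range of_real"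
    unfolding islimpt_approachable
  proof (intro allI impI)
    fix e :: real assume "e > 0"
    then show "\<exists>x'\<in>range of_real. x' \<noteq> 0 \<and> dist x' (0::complex) < e"
      by (intro bexI[of _ "of_real (e / 2)"] rangeI) auto
  qed
qed (use assms(2) in auto)

section \<open>Exponential integrals and uniqueness of the Fourier transform\<close>

lemma borel_measurable_complex_cnj [measurable]:
  "f \<in> borel_measurable M \<Longrightarrow> (\<lambda>x. cnj (f x)) \<in> borel_measurable M"
  by (rule borel_measurable_continuous_on[OF continuous_on_cnj]) (auto intro: continuous_on_id)

text \<open>
  Expanding the exponential gives a power series in \<open>s\<close> whose coefficients are moments; the hypothesis makes
  the interchange of sum and integral legitimate for every \<open>s\<close>.
\<close>

lemma holomorphic_exponential_integral:
  fixes \<phi> :: "'a \<Rightarrow> complex" and u :: "'a \<Rightarrow> real"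
  assumes [measurable]: "\<phi> \<in> borel_measurable M" "u \<in> borel_measurable M"
    and int: "\<And>R. integrable M (\<lambda>t. norm (\<phi> t) * exp (R * \<bar>u t\<bar>))"
  shows "(\<lambda>s. LINT t|M. \<phi> t * exp (s * of_real (u t))) holomorphic_on UNIV"
proof -
  define a where "a n = (LINT t|M. \<phi> t * of_real (u t ^ n / fact n))" for n
  have "(\<lambda>n. a n * (s - 0) ^ n) sums (LINT t|M. \<phi> t * exp (s * of_real (u t)))" for s
  proof -
    define f where "f n t = \<phi> t * (s * of_real (u t)) ^ n /\<^sub>R fact n" for n t
    have norm_f: "norm (f n t) = norm (\<phi> t) * ((norm s * \<bar>u t\<bar>) ^ n /\<^sub>R fact n)" for n t
      by (simp add: f_def norm_mult norm_power norm_divide divide_inverse)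
    have exp_sums: "(\<lambda>n. norm (f n t)) sums (norm (\<phi> t) * exp (norm s * \<bar>u t\<bar>))" for t
      unfolding norm_f by (intro sums_mult exp_converges)
    have f_le: "norm (f n t) \<le> norm (\<phi> t) * exp (norm s * \<bar>u t\<bar>)" for n t
      using sum_le_suminf[OF sums_summable[OF exp_sums], of "{n}" t] sums_unique[OF exp_sums, of t] by simp
    have [measurable]: "f n \<in> borel_measurable M" for n
      unfolding f_def by measurable
    have f_int: "integrable M (f n)" for n
      by (rule Bochner_Integration.integrable_bound[OF int[of "norm s"]]) (use f_le[of n] in auto)
    have "(\<lambda>n. LINT t|M. f n t) sums (LINT t|M. (\<Sum>n. f n t))"
    proof (rule sums_integral[OF f_int])
      show "AE t in M. summable (\<lambda>n. norm (f n t))"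
        using sums_summable[OF exp_sums] by auto
      show "summable (\<lambda>n. LINT t|M. norm (f n t))"
      proof (rule summableI_nonneg_bounded)
        fix n
        have "(\<Sum>i<n. LINT t|M. norm (f i t)) = (LINT t|M. (\<Sum>i<n. norm (f i t)))"
          using f_int by (subst Bochner_Integration.integral_sum) auto
        also have "\<dots> \<le> (LINT t|M. norm (\<phi> t) * exp (norm s * \<bar>u t\<bar>))"
        proof (rule integral_mono[OF _ int])
          show "(\<Sum>i<n. norm (f i t)) \<le> norm (\<phi> t) * exp (norm s * \<bar>u t\<bar>)" for t
            using sum_le_suminf[OF sums_summable[OF exp_sums], of "{..<n}" t] sums_unique[OF exp_sums, of t] by simp
        qed (use f_int in auto)
        finally show "(\<Sum>i<n. LINT t|M. norm (f i t)) \<le> (LINT t|M. norm (\<phi> t) * exp (norm s * \<bar>u t\<bar>))" .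
      qed simp
    qed
    moreover have "(\<Sum>n. f n t) = \<phi> t * exp (s * of_real (u t))" for t
    proof -
      have "(\<lambda>n. \<phi> t * ((s * of_real (u t)) ^ n /\<^sub>R fact n)) sums (\<phi> t * exp (s * of_real (u t)))"
        by (intro sums_mult exp_converges)
      then show ?thesis unfolding f_def by (simp add: sums_unique[symmetric])
    qed
    moreover have "(LINT t|M. f n t) = a n * (s - 0) ^ n" for n
    proof -
      have "f n = (\<lambda>t. (\<phi> t * of_real (u t ^ n / fact n)) * s ^ n)"
        by (auto simp: f_def power_mult_distrib scaleR_conv_of_real field_simps)
      then show ?thesis by (simp add: a_def)
    qed
    ultimately show ?thesis by simp
  qed
  then have "(\<lambda>s. LINT t|M. \<phi> t * exp (s * of_real (u t))) holomorphic_on ball 0 r" for r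
    by (intro power_series_holomorphic)
  moreover have "(\<Union>n::nat. ball 0 (real n)) = (UNIV :: complex set)"
    by (auto simp: reals_Archimedean2)
  ultimately show ?thesis
    using holomorphic_on_UN_open[of "UNIV :: nat set" "\<lambda>s. LINT t|M. \<phi> t * exp (s * of_real (u t))" "\<lambda>n. ball 0 (real n)"]
    by simp
qed

text \<open>
  The normalised positive and negative parts of \<open>h\<close> are densities of two probability measures
  with the same characteristic function, so they coincide by Levy's uniqueness theorem.
\<close>

lemma AE_zero_if_real_Fourier_zero:
  fixes h :: "real \<Rightarrow> real"
  assumes int: "integrable lborel h"
    and zero: "\<And>w. (LINT x|lborel. h x * cis (w * x)) = 0"
  shows "AE x in lborel. h x = 0"
proof -
  have [measurable]: "h \<in> borel_measurable borel" using int by auto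
  define p where "p x = max (h x) 0" for x
  define n where "n x = max (- h x) 0" for x
  have [measurable]: "p \<in> borel_measurable borel" "n \<in> borel_measurable borel"
    unfolding p_def n_def by measurable
  have h: "h x = p x - n x" and nonneg: "0 \<le> p x" "0 \<le> n x" for x by (auto simp: p_def n_def)
  have pint: "integrable lborel p" and nint: "integrable lborel n"
    unfolding p_def n_def using int by auto
  have cint: "integrable lborel (\<lambda>x. of_real (p x) * cis (w * x))" "integrable lborel (\<lambda>x. of_real (n x) * cis (w * x))" for w
    by (rule Bochner_Integration.integrable_bound[OF pint] Bochner_Integration.integrable_bound[OF nint];
        (simp add: norm_mult nonneg cis_conv_exp))+
  have eq: "(LINT x|lborel. of_real (p x) * cis (w * x)) = (LINT x|lborel. of_real (n x) * cis (w * x))" for w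
  proof -
    have "(LINT x|lborel. of_real (p x) * cis (w * x)) - (LINT x|lborel. of_real (n x) * cis (w * x))
        = (LINT x|lborel. of_real (h x) * cis (w * x))"
      using cint[of w] by (subst Bochner_Integration.integral_diff[symmetric]) (auto simp: h algebra_simps)
    then show ?thesis using zero[of w] by simp
  qed
  define m where "m = (LINT x|lborel. p x)"
  have m: "(LINT x|lborel. n x) = m"
    using eq[of 0] by (simp add: m_def integral_complex_of_real)
  have m0: "0 \<le> m" unfolding m_def using nonneg by (intro integral_nonneg_AE) auto
  show ?thesis
  proof (cases "m = 0")
    case True
    have "AE x in lborel. p x = 0" 
      using True nonneg unfolding m_def by (subst (asm) integral_nonneg_eq_0_iff_AE[OF pint]) auto
    moreover have "AE x in lborel. n x = 0"
      using True nonneg unfolding m[symmetric] by (subst (asm) integral_nonneg_eq_0_iff_AE[OF nint]) auto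
    ultimately show ?thesis by eventually_elim (simp add: h)
  next
    case False
    then have mpos: "m > 0" using m0 by simp
    have dist: "real_distribution (density lborel (\<lambda>x. ennreal (q x / m)))"
      if q: "\<And>x. 0 \<le> q x" "integrable lborel q" "(LINT x|lborel. q x) = m" for q
    proof -
      have [measurable]: "q \<in> borel_measurable borel" using q(2) by auto
      have "emeasure (density lborel (\<lambda>x. ennreal (q x / m))) UNIV = (\<integral>\<^sup>+ x. ennreal (q x / m) \<partial>lborel)"
        by (simp add: emeasure_density)
      also have "\<dots> = ennreal (LINT x|lborel. q x / m)"
        using q mpos by (intro nn_integral_eq_integral) auto
      also have "\<dots> = 1" using q mpos by simp
      finally show ?thesis
        by (auto simp: real_distribution_def real_distribution_axioms_def intro!: prob_spaceI)
    qed
    have char: "char (density lborel (\<lambda>x. ennreal (q x / m))) w = (LINT x|lborel. of_real (q x) * cis (w * x)) / m"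
      if q: "\<And>x. 0 \<le> q x" "integrable lborel q" for q w
    proof -
      have [measurable]: "q \<in> borel_measurable borel" using q(2) by auto
      have "char (density lborel (\<lambda>x. ennreal (q x / m))) w = (LINT x|lborel. (q x / m) *\<^sub>R iexp (w * x))"
        unfolding char_def using q mpos by (subst integral_density) auto
      also have "\<dots> = (LINT x|lborel. (of_real (q x) * cis (w * x)) / m)"
        by (intro Bochner_Integration.integral_cong) (auto simp: cis_conv_exp scaleR_conv_of_real)
      finally show ?thesis by simp
    qed
    have "density lborel (\<lambda>x. ennreal (p x / m)) = density lborel (\<lambda>x. ennreal (n x / m))"
    proof (rule Levy_uniqueness)
      show "char (density lborel (\<lambda>x. ennreal (p x / m))) = char (density lborel (\<lambda>x. ennreal (n x / m)))"
        using eq by (intro ext) (simp add: char nonneg pint nint)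
    qed (auto intro!: dist nonneg pint nint simp: m m_def[symmetric])
    then have "AE x in lborel. ennreal (p x / m) = ennreal (n x / m)"
      by (subst (asm) sigma_finite_measure.density_unique_iff[OF sigma_finite_lborel]) auto
    then show ?thesis
      by eventually_elim (use mpos nonneg in \<open>auto simp: h divide_cancel_right\<close>)
  qed
qed

text \<open>
  Restricting to rational frequencies costs nothing, as the Fourier transform is continuous. It is this
  countable version that allows exchanging ``for all frequencies'' and ``almost everywhere''
  when coordinates are split off one at a time.
\<close>

lemma AE_zero_if_Fourier_zero_on_Rats:
  fixes \<phi> :: "real \<Rightarrow> complex"
  assumes int: "integrable lborel \<phi>"
    and zero: "\<And>w. w \<in> \<rat> \<Longrightarrow> (LINT x|lborel. \<phi> x * cis (w * x)) = 0"
  shows "AE x in lborel. \<phi> x = 0"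
proof -
  have [measurable]: "\<phi> \<in> borel_measurable borel" using int by auto
  have cint: "integrable lborel (\<lambda>x. \<phi> x * cis (w * x))" for w
    by (rule Bochner_Integration.integrable_bound[OF int]) (auto simp: norm_mult cis_conv_exp)
  have all: "(LINT x|lborel. \<phi> x * cis (w * x)) = 0" for w
  proof -
    have "w \<in> closure \<rat>" by (simp add: Rats_closure_real)
    then obtain q where q: "\<And>n. q n \<in> \<rat>" "q \<longlonglongrightarrow> w"
      unfolding closure_sequential by blast
    have "(\<lambda>n. LINT x|lborel. \<phi> x * cis (q n * x)) \<longlonglongrightarrow> (LINT x|lborel. \<phi> x * cis (w * x))"
    proof (rule integral_dominated_convergence[where w = "\<lambda>x. norm (\<phi> x)"])
      show "AE x in lborel. (\<lambda>n. \<phi> x * cis (q n * x)) \<longlonglongrightarrow> \<phi> x * cis (w * x)"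
        unfolding cis_conv_exp by (intro AE_I2 tendsto_intros q)
    qed (use int in \<open>auto simp: norm_mult cis_conv_exp\<close>)
    then show ?thesis
      using zero[OF q(1)] by (simp add: LIMSEQ_const_iff)
  qed
  have cnj: "(LINT x|lborel. cnj (\<phi> x) * cis (w * x)) = 0" for w
  proof -
    have "(LINT x|lborel. cnj (\<phi> x) * cis (w * x)) = (LINT x|lborel. cnj (\<phi> x * cis ((- w) * x)))"
      by (intro Bochner_Integration.integral_cong) (auto simp: cis_cnj)
    also have "\<dots> = cnj 0" by (subst Bochner_Integration.integral_cnj) (simp only: all)
    finally show ?thesis by simp
  qed
  have cint': "integrable lborel (\<lambda>x. cnj (\<phi> x) * cis (w * x))" for w
    by (rule Bochner_Integration.integrable_bound[OF int]) (auto simp: norm_mult cis_conv_exp)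
  have "AE x in lborel. Re (\<phi> x) = 0"
  proof (rule AE_zero_if_real_Fourier_zero)
    fix w
    have "(LINT x|lborel. of_real (Re (\<phi> x)) * cis (w * x))
        = (LINT x|lborel. (\<phi> x * cis (w * x) + cnj (\<phi> x) * cis (w * x)) / 2)"
      by (intro Bochner_Integration.integral_cong) (auto simp: complex_eq_iff algebra_simps)
    also have "\<dots> = 0" using cint cint' by (simp add: all cnj)
    finally show "(LINT x|lborel. of_real (Re (\<phi> x)) * cis (w * x)) = 0" .
  qed (use int in auto)
  moreover have "AE x in lborel. Im (\<phi> x) = 0"
  proof (rule AE_zero_if_real_Fourier_zero)
    fix w
    have "(LINT x|lborel. of_real (Im (\<phi> x)) * cis (w * x))
        = (LINT x|lborel. (\<phi> x * cis (w * x) - cnj (\<phi> x) * cis (w * x)) / (2 * \<i>))"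
      by (intro Bochner_Integration.integral_cong) (auto simp: complex_eq_iff algebra_simps Re_divide Im_divide)
    also have "\<dots> = 0" using cint cint' by (simp add: all cnj)
    finally show "(LINT x|lborel. of_real (Im (\<phi> x)) * cis (w * x)) = 0" .
  qed (use int in auto)
  ultimately show ?thesis by eventually_elim (simp add: complex_eq_iff)
qed

abbreviation lborel_on :: "'i set \<Rightarrow> ('i \<Rightarrow> real) measure" where
  "lborel_on K \<equiv> Pi\<^sub>M K (\<lambda>_. lborel)"

interpretation lebesgue_product: product_sigma_finite "\<lambda>_. lborel :: real measure"
  by standard

lemma sigma_finite_lborel_on: "finite K \<Longrightarrow> sigma_finite_measure (lborel_on K)"
  by (rule lebesgue_product.sigma_finite)

text \<open>
  Uniqueness of the Fourier transform in several variables reduces to one variable: for each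
  fixed rational frequency in the coordinates of \<open>K\<close>, the partial transform is an integrable function of the new
  coordinate with vanishing Fourier transform.
\<close>

lemma AE_zero_if_Fourier_zero_on_product:
  fixes \<phi> :: "('i \<Rightarrow> real) \<Rightarrow> complex"
  assumes "finite K" and "integrable (lborel_on K) \<phi>"
    and "\<And>w. (\<And>i. w i \<in> \<rat>) \<Longrightarrow> (LINT t|lborel_on K. \<phi> t * cis (\<Sum>i\<in>K. w i * t i)) = 0"
  shows "AE t in lborel_on K. \<phi> t = 0"
  using assms
proof (induction K arbitrary: \<phi> rule: finite_induct)
  case empty
  have "(LINT t|lborel_on {}. \<phi> t) = \<phi> (\<lambda>_. undefined)"
    by (simp add: PiM_empty lebesgue_integral_count_space_finite)
  then have "\<phi> (\<lambda>_. undefined) = 0" using empty(2)[of "\<lambda>_. 0"] by simp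
  then show ?case by (intro AE_I2) (simp add: space_PiM)
next
  case (insert i K)
  note [simp] = insert(1,2)
  interpret K: sigma_finite_measure "lborel_on K" by (rule sigma_finite_lborel_on) simp
  interpret P: pair_sigma_finite "lborel_on K" "lborel :: real measure" ..
  have \<phi>_meas[measurable]: "\<phi> \<in> borel_measurable (lborel_on (insert i K))" using insert.prems by auto
  have upd[measurable]: "(\<lambda>(t, s). t(i := s)) \<in> measurable (lborel_on K \<Otimes>\<^sub>M lborel) (lborel_on (insert i K))"
    using measurable_add_dim[of i K "\<lambda>_. lborel"] by simp
  have \<phi>2[measurable]: "(\<lambda>x. \<phi> ((fst x)(i := snd x))) \<in> borel_measurable (lborel_on K \<Otimes>\<^sub>M lborel)"
    using measurable_compose[OF upd \<phi>_meas] by (simp add: case_prod_beta')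
  have "(\<integral>\<^sup>+ x. norm (\<phi> ((fst x)(i := snd x))) \<partial>(lborel_on K \<Otimes>\<^sub>M lborel))
      = (\<integral>\<^sup>+ t. (\<integral>\<^sup>+ s. norm (\<phi> (t(i := s))) \<partial>lborel) \<partial>lborel_on K)"
    by (subst lborel.nn_integral_fst[symmetric]) auto
  also have "\<dots> = (\<integral>\<^sup>+ t. norm (\<phi> t) \<partial>lborel_on (insert i K))"
    by (subst lebesgue_product.product_nn_integral_insert) auto
  also have "\<dots> < \<infinity>" using insert.prems by (auto simp: integrable_iff_bounded)
  finally have int2: "integrable (lborel_on K \<Otimes>\<^sub>M lborel) (\<lambda>x. \<phi> ((fst x)(i := snd x)))"
    by (auto simp: integrable_iff_bounded)
  have [measurable]: "(\<lambda>x. cis (\<Sum>j\<in>K. w j * (fst x) j)) \<in> borel_measurable (lborel_on K \<Otimes>\<^sub>M (lborel :: real measure))" for w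
    unfolding cis_conv_exp by measurable
  have int3: "integrable (lborel_on K \<Otimes>\<^sub>M lborel) (\<lambda>x. \<phi> ((fst x)(i := snd x)) * cis (\<Sum>j\<in>K. w j * (fst x) j))" for w
    by (rule Bochner_Integration.integrable_bound[OF int2]) (auto simp: norm_mult)
  define \<psi> where "\<psi> w s = (LINT t|lborel_on K. \<phi> (t(i := s)) * cis (\<Sum>j\<in>K. w j * t j))" for w s
  have \<psi>_zero: "AE s in lborel. \<psi> w s = 0" if w: "\<And>j. w j \<in> \<rat>" for w
  proof (rule AE_zero_if_Fourier_zero_on_Rats)
    show "integrable lborel (\<psi> w)"
      using P.integrable_snd[of "\<lambda>t s. \<phi> (t(i := s)) * cis (\<Sum>j\<in>K. w j * t j)"] int3[of w]
      by (simp add: \<psi>_def[abs_def] case_prod_beta')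
    fix q :: real assume q: "q \<in> \<rat>"
    have "(\<Sum>j\<in>insert i K. (w(i := q)) j * (t(i := s)) j) = q * s + (\<Sum>j\<in>K. w j * t j)" for t s
    proof -
      have "(\<Sum>j\<in>K. (w(i := q)) j * (t(i := s)) j) = (\<Sum>j\<in>K. w j * t j)"
        by (intro sum.cong) auto
      then show ?thesis by simp
    qed
    then have split: "\<phi> (t(i := s)) * cis (\<Sum>j\<in>insert i K. (w(i := q)) j * (t(i := s)) j)
        = \<phi> (t(i := s)) * cis (\<Sum>j\<in>K. w j * t j) * cis (q * s)" for t s
      by (simp only: cis_mult[symmetric] mult_ac)
    have int4: "integrable (lborel_on K \<Otimes>\<^sub>M lborel) (\<lambda>(t, s). \<phi> (t(i := s)) * cis (\<Sum>j\<in>K. w j * t j) * cis (q * s))"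
      by (rule Bochner_Integration.integrable_bound[OF int2]) (auto simp: norm_mult case_prod_beta' cis_conv_exp)
    have "(LINT s|lborel. \<psi> w s * cis (q * s)) = (LINT s|lborel. LINT t|lborel_on K. \<phi> (t(i := s)) * cis (\<Sum>j\<in>K. w j * t j) * cis (q * s))"
      by (simp add: \<psi>_def)
    also have "\<dots> = (LINT t|lborel_on K. LINT s|lborel. \<phi> (t(i := s)) * cis (\<Sum>j\<in>K. w j * t j) * cis (q * s))"
      by (rule P.Fubini_integral[OF int4])
    also have "\<dots> = (LINT t|lborel_on (insert i K). \<phi> t * cis (\<Sum>j\<in>insert i K. (w(i := q)) j * t j))"
      unfolding split[symmetric]
    proof (rule lebesgue_product.product_integral_insert[symmetric])
      show "integrable (lborel_on (insert i K)) (\<lambda>t. \<phi> t * cis (\<Sum>j\<in>insert i K. (w(i := q)) j * t j))"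
        by (rule Bochner_Integration.integrable_bound[OF insert.prems(1)]) (auto simp: norm_mult cis_conv_exp)
    qed auto
    also have "\<dots> = 0" using w q by (intro insert.prems(2)) auto
    finally show "(LINT s|lborel. \<psi> w s * cis (q * s)) = 0" .
  qed
  define W where "W = (\<lambda>w j. if j \<in> K then w j else 0) ` (PiE K (\<lambda>_. \<rat> :: real set))"
  have "countable W" unfolding W_def
    by (intro countable_image countable_PiE) (auto simp: countable_rat)
  have W_rat: "w j \<in> \<rat>" if "w \<in> W" for w j
    using that by (auto simp: W_def)
  have "AE s in lborel. \<forall>w\<in>W. \<psi> w s = 0"
    using \<open>countable W\<close> \<psi>_zero W_rat by (subst AE_ball_countable) auto
  moreover have "AE s in lborel. integrable (lborel_on K) (\<lambda>t. \<phi> (t(i := s)))"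
    using P.AE_integrable_snd[of "\<lambda>t s. \<phi> (t(i := s))"] int2 by (simp add: case_prod_beta')
  ultimately have AE: "AE s in lborel. AE t in lborel_on K. \<phi> (t(i := s)) = 0"
  proof eventually_elim
    case (elim s)
    show ?case
    proof (rule insert.IH[OF elim(2)])
      fix w :: "'i \<Rightarrow> real" assume w: "\<And>j. w j \<in> \<rat>"
      have "(\<lambda>j. if j \<in> K then w j else 0) \<in> W"
        unfolding W_def using w by (intro image_eqI[of _ _ "restrict w K"]) auto
      then have "\<psi> (\<lambda>j. if j \<in> K then w j else 0) s = 0" using elim(1) by auto
      moreover have "(\<Sum>j\<in>K. (if j \<in> K then w j else 0) * t j) = (\<Sum>j\<in>K. w j * t j)" for t
        by (intro sum.cong) auto
      ultimately show "(LINT t|lborel_on K. \<phi> (t(i := s)) * cis (\<Sum>j\<in>K. w j * t j)) = 0"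
        by (simp add: \<psi>_def)
    qed
  qed
  have "(\<integral>\<^sup>+ t. norm (\<phi> t) \<partial>lborel_on (insert i K)) = (\<integral>\<^sup>+ s. \<integral>\<^sup>+ t. norm (\<phi> (t(i := s))) \<partial>lborel_on K \<partial>lborel)"
    by (subst lebesgue_product.product_nn_integral_insert_rev) auto
  also have "\<dots> = (\<integral>\<^sup>+ (s::real). 0 \<partial>lborel)"
  proof (rule nn_integral_cong_AE)
    show "AE s in lborel. (\<integral>\<^sup>+ t. norm (\<phi> (t(i := s))) \<partial>lborel_on K) = 0"
      using AE
    proof eventually_elim
      case (elim s)
      then have "(\<integral>\<^sup>+ t. norm (\<phi> (t(i := s))) \<partial>lborel_on K) = (\<integral>\<^sup>+ t. 0 \<partial>lborel_on K)"
        by (intro nn_integral_cong_AE) (auto elim!: eventually_mono)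
      then show ?case by simp
    qed
  qed
  finally have "(\<integral>\<^sup>+ t. norm (\<phi> t) \<partial>lborel_on (insert i K)) = 0" by simp
  then show ?case
    by (subst (asm) nn_integral_0_iff_AE) auto
qed

section \<open>Gaussian integrals and invariance of product Lebesgue measure\<close>

lemma exp_mult_abs_le: "exp (R * \<bar>u\<bar>) \<le> exp (R * u) + exp (- (R * u))" for R u :: real
  by (cases "u \<ge> 0") auto

lemma integrable_Gaussian_linear:
  assumes a: "(a::real) > 0"
  shows "integrable lborel (\<lambda>x::real. exp (- a * x\<^sup>2 + b * x))"
proof -
  have "exp (- a * x\<^sup>2 + b * x) = (exp (b\<^sup>2 / (4 * a)) * sqrt (pi / a)) * normal_density (b / (2 * a)) (sqrt (1 / (2 * a))) x" for x
  proof -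
    have 1: "2 * (sqrt (1 / (2 * a)))\<^sup>2 = 1 / a" using a by simp
    have 2: "sqrt (2 * pi * (sqrt (1 / (2 * a)))\<^sup>2) = sqrt (pi / a)" using a by simp
    have 3: "- a * x\<^sup>2 + b * x = b\<^sup>2 / (4 * a) + - (x - b / (2 * a))\<^sup>2 / (1 / a)"
      using a by (simp add: field_simps power2_eq_square)
    have 4: "sqrt (pi / a) \<noteq> 0" using a by simp
    show ?thesis
      unfolding normal_density_def 1 2 3 exp_add using 4 by simp
  qed
  moreover have "integrable lborel (normal_density (b / (2 * a)) (sqrt (1 / (2 * a))))"
    using a by (intro integrable_normal_density) auto
  ultimately show ?thesis by simp
qed

lemma real_Gaussian_integral:
  "(LINT x|lborel. exp (- (pi / 2) * x\<^sup>2 + 2 * pi * c * x)) = sqrt 2 * exp (2 * pi * c\<^sup>2)"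
proof -
  have "exp (- (pi / 2) * x\<^sup>2 + 2 * pi * c * x) = (exp (2 * pi * c\<^sup>2) * sqrt 2) * normal_density (2 * c) (sqrt (1 / pi)) x" for x
  proof -
    have 1: "- (pi / 2) * x\<^sup>2 + 2 * pi * c * x = 2 * pi * c\<^sup>2 + - (x - 2 * c)\<^sup>2 / (2 * (sqrt (1 / pi))\<^sup>2)"
      by (simp add: field_simps power2_eq_square)
    show ?thesis
      unfolding normal_density_def 1 exp_add by simp
  qed
  then show ?thesis
    using integral_normal_density[of "sqrt (1 / pi)" "2 * c"] by simp
qed

text \<open>
  Both sides are entire in \<open>c\<close>, and for real \<open>c\<close> the formula is the normalisation of a normal density.
\<close>

lemma complex_Gaussian_integral:
  "(LINT x|lborel. exp (- (of_real pi / 2) * (of_real x)\<^sup>2 + 2 * of_real pi * c * of_real x)) = of_real (sqrt 2) * exp (2 * of_real pi * c\<^sup>2)" for c :: complex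
proof -
  let ?f = "\<lambda>s :: complex. LINT x|lborel. of_real (exp (- (pi / 2) * x\<^sup>2)) * exp (s * of_real (2 * pi * x))"
  have "?f holomorphic_on UNIV"
  proof (rule holomorphic_exponential_integral)
    fix R :: real
    have "integrable lborel (\<lambda>x. exp (- (pi / 2) * x\<^sup>2 + (R * (2 * pi)) * x) + exp (- (pi / 2) * x\<^sup>2 + (- R * (2 * pi)) * x))"
      by (intro Bochner_Integration.integrable_add integrable_Gaussian_linear) auto
    then show "integrable lborel (\<lambda>x. norm (complex_of_real (exp (- (pi / 2) * x\<^sup>2))) * exp (R * \<bar>2 * pi * x\<bar>))"
    proof (rule Bochner_Integration.integrable_bound)
      show "AE x in lborel. norm (norm (complex_of_real (exp (- (pi / 2) * x\<^sup>2))) * exp (R * \<bar>2 * pi * x\<bar>))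
        \<le> norm (exp (- (pi / 2) * x\<^sup>2 + (R * (2 * pi)) * x) + exp (- (pi / 2) * x\<^sup>2 + (- R * (2 * pi)) * x))"
        proof (intro AE_I2)
        fix x :: real
        have "exp (- (pi / 2) * x\<^sup>2) * exp (R * \<bar>2 * pi * x\<bar>)
            \<le> exp (- (pi / 2) * x\<^sup>2) * (exp (R * (2 * pi * x)) + exp (- (R * (2 * pi * x))))"
          by (intro mult_left_mono exp_mult_abs_le) auto
        also have "\<dots> = exp (- (pi / 2) * x\<^sup>2 + (R * (2 * pi)) * x) + exp (- (pi / 2) * x\<^sup>2 + (- R * (2 * pi)) * x)"
          by (simp add: exp_add[symmetric] algebra_simps)
        finally show "norm (norm (complex_of_real (exp (- (pi / 2) * x\<^sup>2))) * exp (R * \<bar>2 * pi * x\<bar>))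
        \<le> norm (exp (- (pi / 2) * x\<^sup>2 + (R * (2 * pi)) * x) + exp (- (pi / 2) * x\<^sup>2 + (- R * (2 * pi)) * x))"
          by simp
      qed
    qed measurable
  qed auto
  moreover have "(\<lambda>c. of_real (sqrt 2) * exp (2 * of_real pi * c\<^sup>2)) holomorphic_on UNIV"
    by (intro holomorphic_intros)
  ultimately have hol: "(\<lambda>c. ?f c - of_real (sqrt 2) * exp (2 * of_real pi * c\<^sup>2)) holomorphic_on UNIV"
    by (rule holomorphic_on_diff)
  have real: "?f (of_real x) - of_real (sqrt 2) * exp (2 * of_real pi * (of_real x)\<^sup>2) = 0" for x
  proof -
    have "?f (of_real x) = (LINT y|lborel. of_real (exp (- (pi / 2) * y\<^sup>2 + 2 * pi * x * y)))"
      unfolding exp_of_real[symmetric] exp_add[symmetric]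
      by (intro Bochner_Integration.integral_cong arg_cong[where f = exp] refl) (simp add: algebra_simps)
    also have "\<dots> = of_real (sqrt 2 * exp (2 * pi * x\<^sup>2))"
      by (simp only: real_Gaussian_integral Bochner_Integration.integral_complex_of_real)
    finally show ?thesis by (simp flip: exp_of_real)
  qed
  have "?f c - of_real (sqrt 2) * exp (2 * of_real pi * c\<^sup>2) = 0"
    by (rule entire_zero_if_zero_on_reals[OF hol real])
  then have "?f c = of_real (sqrt 2) * exp (2 * of_real pi * c\<^sup>2)" by simp
  moreover have "?f c = (LINT x|lborel. exp (- (of_real pi / 2) * (of_real x)\<^sup>2 + 2 * of_real pi * c * of_real x))"
    by (intro Bochner_Integration.integral_cong) (auto simp: algebra_simps simp flip: exp_of_real exp_add)
  ultimately show ?thesis by simp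
qed

lemma integrable_complex_Gaussian:
  "integrable lborel (\<lambda>x. exp (- (of_real pi / 2) * (of_real x)\<^sup>2 + 2 * of_real pi * c * of_real x))" for c :: complex
proof -
  have "integrable lborel (\<lambda>x. exp (- (pi / 2) * x\<^sup>2 + (2 * pi * Re c) * x))"
    by (intro integrable_Gaussian_linear) auto
  then show ?thesis
    by (rule Bochner_Integration.integrable_bound)
      (auto simp: norm_exp_eq_Re power2_eq_square)
qed

lemma product_Gaussian_integral:
  fixes c :: "'i \<Rightarrow> complex"
  assumes "finite K"
  shows "(LINT w|lborel_on K. exp (\<Sum>i\<in>K. - (of_real pi / 2) * (of_real (w i))\<^sup>2 + 2 * of_real pi * c i * of_real (w i)))
    = of_real (sqrt 2 ^ card K) * exp (\<Sum>i\<in>K. 2 * of_real pi * (c i)\<^sup>2)"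
  unfolding exp_sum[OF assms]
  by (subst lebesgue_product.product_integral_prod[OF assms integrable_complex_Gaussian])
    (simp only: complex_Gaussian_integral prod.distrib exp_sum[OF assms] prod_constant of_real_power)

lemma integrable_product_Gaussian_linear:
  fixes b :: "'i \<Rightarrow> real"
  assumes "finite K" "a > 0"
  shows "integrable (lborel_on K) (\<lambda>t. exp (\<Sum>i\<in>K. - a * (t i)\<^sup>2 + b i * t i))"
  unfolding exp_sum[OF assms(1)]
  by (rule lebesgue_product.product_integrable_prod[OF assms(1) integrable_Gaussian_linear[OF assms(2)]])

text \<open>
  Product Lebesgue measure over an abstract finite index set is not an instance of a Euclidean space, so
  its invariance under translations and reflections is derived from the one-dimensional case.
\<close>

lemma distr_lborel_on_componentwise:
  fixes \<tau> :: "'i \<Rightarrow> real \<Rightarrow> real"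
  assumes K: "finite K" and inv: "\<And>i. i \<in> K \<Longrightarrow> distr lborel lborel (\<tau> i) = lborel"
    and meas: "\<And>i. i \<in> K \<Longrightarrow> \<tau> i \<in> borel_measurable borel"
  shows "distr (lborel_on K) (lborel_on K) (\<lambda>t. \<lambda>i\<in>K. \<tau> i (t i)) = lborel_on K"
proof (rule lebesgue_product.PiM_eqI[OF K])
  fix A :: "'i \<Rightarrow> real set" assume A: "\<And>i. i \<in> K \<Longrightarrow> A i \<in> sets lborel"
  interpret finite_product_sigma_finite "\<lambda>_. lborel :: real measure" K by standard fact
  have m: "(\<lambda>t. \<lambda>i\<in>K. \<tau> i (t i)) \<in> measurable (lborel_on K) (lborel_on K)"
    using meas by (intro measurable_restrict measurable_compose[OF measurable_component_singleton]) auto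
  have vim: "(\<lambda>t. \<lambda>i\<in>K. \<tau> i (t i)) -` Pi\<^sub>E K A \<inter> space (lborel_on K) = Pi\<^sub>E K (\<lambda>i. \<tau> i -` A i)"
    by (auto simp: space_PiM PiE_iff)
  have "emeasure (distr (lborel_on K) (lborel_on K) (\<lambda>t. \<lambda>i\<in>K. \<tau> i (t i))) (Pi\<^sub>E K A)
      = emeasure (lborel_on K) (Pi\<^sub>E K (\<lambda>i. \<tau> i -` A i))"
    using A K by (subst emeasure_distr[OF m]) (auto simp: vim intro!: sets_PiM_I_finite)
  also have "\<dots> = (\<Prod>i\<in>K. emeasure lborel (\<tau> i -` A i))"
    using meas A by (intro measure_times) (auto intro: measurable_sets_borel)
  also have "\<dots> = (\<Prod>i\<in>K. emeasure lborel (A i))"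
  proof (rule prod.cong[OF refl])
    fix i assume i: "i \<in> K"
    have "emeasure lborel (A i) = emeasure (distr lborel lborel (\<tau> i)) (A i)" using inv[OF i] by simp
    also have "\<dots> = emeasure lborel (\<tau> i -` A i)"
      using meas[OF i] A[OF i] by (subst emeasure_distr) auto
    finally show "emeasure lborel (\<tau> i -` A i) = emeasure lborel (A i)" ..
  qed
  finally show "emeasure (distr (lborel_on K) (lborel_on K) (\<lambda>t. \<lambda>i\<in>K. \<tau> i (t i))) (Pi\<^sub>E K A) = (\<Prod>i\<in>K. emeasure lborel (A i))" .
qed simp

lemma distr_lborel_on_reflect_translate:
  assumes "finite K"
  shows "distr (lborel_on K) (lborel_on K) (\<lambda>t. \<lambda>i\<in>K. c i - t i) = lborel_on K"
proof (rule distr_lborel_on_componentwise[OF assms])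
  have "distr lborel lborel (\<lambda>x. a - x) = lborel" for a :: real
  proof -
    have "distr lborel lborel (\<lambda>x. a - x) = distr (distr lborel lborel uminus) lborel ((+) a)"
      by (subst distr_distr) (auto simp: o_def)
    also have "distr lborel lborel uminus = (lborel :: real measure)"
      using lborel_distr_uminus by (simp cong: distr_cong)
    also have "distr lborel lborel ((+) a) = lborel"
      using lborel_distr_plus[of a] by (simp cong: distr_cong)
    finally show ?thesis .
  qed
  then show "distr lborel lborel ((-) (c i)) = lborel" for i by simp
qed auto

section \<open>The Bargmann transform\<close>

definition square_integrable_on :: "'i set \<Rightarrow> (('i \<Rightarrow> real) \<Rightarrow> complex) \<Rightarrow> bool" where
  "square_integrable_on K f \<longleftrightarrow> f \<in> borel_measurable (lborel_on K) \<and> integrable (lborel_on K) (\<lambda>t. (norm (f t))\<^sup>2)"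

text \<open>
  The short-time Fourier transform in the coordinates of \<open>K\<close>. Elements of the product space are undefined
  outside \<open>K\<close>, which is why the difference is restricted to \<open>K\<close>.
\<close>

definition STFT_on :: "'i set \<Rightarrow> (('i \<Rightarrow> real) \<Rightarrow> complex) \<Rightarrow> (('i \<Rightarrow> real) \<Rightarrow> complex) \<Rightarrow> ('i \<Rightarrow> real) \<Rightarrow> ('i \<Rightarrow> real) \<Rightarrow> complex" where
  "STFT_on K g f x w = (LINT t|lborel_on K. f t * cnj (g (\<lambda>i\<in>K. t i - x i)) * cis (- 2 * pi * (\<Sum>i\<in>K. t i * w i)))"

text \<open>
  The Bargmann transform up to a constant and the factor \<open>exp (- \<pi>/2 \<Sum> \<zeta> i\<^sup>2)\<close>, which has no zeros and which would only obscure the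
  dependence on \<open>\<zeta>\<close> through a plain exponential.
\<close>

definition bargmann :: "'i set \<Rightarrow> (('i \<Rightarrow> real) \<Rightarrow> complex) \<Rightarrow> ('i \<Rightarrow> complex) \<Rightarrow> complex" where
  "bargmann K f \<zeta> = (LINT t|lborel_on K. f t * exp (\<Sum>i\<in>K. - of_real pi * (of_real (t i))\<^sup>2 + 2 * of_real pi * of_real (t i) * \<zeta> i))"

lemma distr_lborel_on_translate:
  assumes "finite K"
  shows "distr (lborel_on K) (lborel_on K) (\<lambda>t. \<lambda>i\<in>K. t i - x i) = lborel_on K"
proof (rule distr_lborel_on_componentwise[OF assms])
  have "distr lborel lborel (\<lambda>t. t - a) = lborel" for a :: real
    using lborel_distr_plus[of "- a"] by (simp cong: distr_cong)
  then show "distr lborel lborel (\<lambda>t. t - x i) = lborel" for i by simp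
qed auto

lemma measurable_coordinate [measurable (raw)]:
  "h \<in> measurable N (lborel_on K) \<Longrightarrow> i \<in> K \<Longrightarrow> (\<lambda>z. h z i) \<in> borel_measurable N"
  using measurable_compose[OF _ measurable_component_singleton, of h N K "\<lambda>_. lborel" i] by simp

lemma measurable_diff_on [measurable (raw)]:
  assumes [measurable]: "h1 \<in> measurable N (lborel_on K)" "h2 \<in> measurable N (lborel_on K)"
  shows "(\<lambda>z. \<lambda>i\<in>K. h1 z i - h2 z i) \<in> measurable N (lborel_on K)"
  by (rule measurable_restrict) measurable

lemma restrict_eq_on_space: "t \<in> space (lborel_on K) \<Longrightarrow> restrict t K = t"
  by (simp add: space_PiM)

text \<open>
  A product of two square-integrable functions: the Gaussian is still square-integrable after multiplication by any
  exponential of a linear form.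
\<close>

lemma integrable_square_integrable_Gaussian:
  fixes b e :: "'i \<Rightarrow> real"
  assumes K: "finite K" and f: "square_integrable_on K f"
  shows "integrable (lborel_on K) (\<lambda>t. norm (f t) * exp (\<Sum>i\<in>K. - pi * (t i)\<^sup>2 + b i * t i) * exp (R * \<bar>\<Sum>i\<in>K. e i * t i\<bar>))"
proof -
  have [measurable]: "f \<in> borel_measurable (lborel_on K)" and f2: "integrable (lborel_on K) (\<lambda>t. (norm (f t))\<^sup>2)"
    using f by (auto simp: square_integrable_on_def)
  define G where "G c t = exp (\<Sum>i\<in>K. - (2 * pi) * (t i)\<^sup>2 + c i * t i)" for c t
  have G: "integrable (lborel_on K) (G c)" for c
    unfolding G_def by (rule integrable_product_Gaussian_linear[OF K]) simp
  have G1: "(exp (\<Sum>i\<in>K. - pi * (t i)\<^sup>2 + b i * t i))\<^sup>2 * exp (2 * r * (\<Sum>i\<in>K. e i * t i))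
      = G (\<lambda>i. 2 * b i + 2 * r * e i) t" for r t
    by (simp add: G_def exp_double[symmetric] exp_add[symmetric] sum_distrib_left sum.distrib[symmetric] algebra_simps)
  have bound: "norm (f t) * exp (\<Sum>i\<in>K. - pi * (t i)\<^sup>2 + b i * t i) * exp (R * \<bar>\<Sum>i\<in>K. e i * t i\<bar>)
      \<le> (norm (f t))\<^sup>2 + (G (\<lambda>i. 2 * b i + 2 * R * e i) t + G (\<lambda>i. 2 * b i + 2 * (- R) * e i) t)" for t
  proof -
    define E where "E = exp (\<Sum>i\<in>K. - pi * (t i)\<^sup>2 + b i * t i)"
    define u where "u = (\<Sum>i\<in>K. e i * t i)"
    have "norm (f t) * (E * exp (R * \<bar>u\<bar>)) \<le> (norm (f t))\<^sup>2 + (E * exp (R * \<bar>u\<bar>))\<^sup>2"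
    proof -
      have "0 \<le> norm (f t) * (E * exp (R * \<bar>u\<bar>))" unfolding E_def by auto
      moreover have "2 * (norm (f t) * (E * exp (R * \<bar>u\<bar>))) \<le> (norm (f t))\<^sup>2 + (E * exp (R * \<bar>u\<bar>))\<^sup>2"
        using sum_squares_bound[of "norm (f t)" "E * exp (R * \<bar>u\<bar>)"] by simp
      ultimately show ?thesis by linarith
    qed
    moreover have "(E * exp (R * \<bar>u\<bar>))\<^sup>2 \<le> E\<^sup>2 * (exp (2 * R * u) + exp (2 * (- R) * u))"
      using exp_mult_abs_le[of "2 * R" u] by (simp add: power_mult_distrib exp_double[symmetric] mult_left_mono mult.assoc)
    ultimately show ?thesis
      using G1[of t R] G1[of t "- R"] by (simp add: E_def u_def algebra_simps)
  qed
  have "integrable (lborel_on K) (\<lambda>t. (norm (f t))\<^sup>2 + (G (\<lambda>i. 2 * b i + 2 * R * e i) t + G (\<lambda>i. 2 * b i + 2 * (- R) * e i) t))"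
    by (intro Bochner_Integration.integrable_add f2 G)
  then show ?thesis
  proof (rule Bochner_Integration.integrable_bound, goal_cases)
    case 2
    show ?case
      unfolding real_norm_def abs_mult abs_exp_cancel abs_norm_cancel
      by (intro AE_I2 order_trans[OF bound abs_ge_self])
  qed measurable
qed

lemma bargmann_line_holomorphic:
  assumes K: "finite K" and f: "square_integrable_on K f"
  shows "(\<lambda>s. bargmann K f (\<lambda>i. of_real (\<eta>0 i) + s * of_real (\<eta>1 i))) holomorphic_on UNIV"
proof -
  have [measurable]: "f \<in> borel_measurable (lborel_on K)" using f by (auto simp: square_integrable_on_def)
  let ?\<phi> = "\<lambda>t. f t * of_real (exp (\<Sum>i\<in>K. - pi * (t i)\<^sup>2 + (2 * pi * \<eta>0 i) * t i))"
  let ?u = "\<lambda>t. \<Sum>i\<in>K. (2 * pi * \<eta>1 i) * t i"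
  have "(\<lambda>s. LINT t|lborel_on K. ?\<phi> t * exp (s * of_real (?u t))) holomorphic_on UNIV"
  proof (rule holomorphic_exponential_integral)
    show "integrable (lborel_on K) (\<lambda>t. norm (?\<phi> t) * exp (R * \<bar>?u t\<bar>))" for R
      using integrable_square_integrable_Gaussian[OF K f, of "\<lambda>i. 2 * pi * \<eta>0 i" R "\<lambda>i. 2 * pi * \<eta>1 i"]
      by (simp add: norm_mult)
  qed measurable
  moreover have "?\<phi> t * exp (s * of_real (?u t)) = f t * exp (\<Sum>i\<in>K. - of_real pi * (of_real (t i))\<^sup>2 + 2 * of_real pi * of_real (t i) * (of_real (\<eta>0 i) + s * of_real (\<eta>1 i)))" for t s
    unfolding exp_of_real[symmetric] mult.assoc exp_add[symmetric]
    by (simp add: sum_distrib_left sum.distrib[symmetric] algebra_simps)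
  ultimately show ?thesis by (simp only: bargmann_def)
qed

text \<open>
  On each real line through the origin the transform extends to an entire function, so it also vanishes at
  purely imaginary points. There it is the Fourier transform of \<open>f\<close> times a Gaussian.
\<close>

lemma bargmann_zero_imp_zero:
  assumes K: "finite K" and f: "square_integrable_on K f"
    and zero: "\<And>\<eta>::'i \<Rightarrow> real. bargmann K f (\<lambda>i. of_real (\<eta> i)) = 0"
  shows "AE t in lborel_on K. f t = 0"
proof -
  have [measurable]: "f \<in> borel_measurable (lborel_on K)" using f by (auto simp: square_integrable_on_def)
  let ?\<phi> = "\<lambda>t. f t * of_real (exp (\<Sum>i\<in>K. - pi * (t i)\<^sup>2))"
  have "AE t in lborel_on K. ?\<phi> t = 0"
  proof (rule AE_zero_if_Fourier_zero_on_product[OF K])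
    show "integrable (lborel_on K) ?\<phi>"
      by (rule Bochner_Integration.integrable_bound[OF integrable_square_integrable_Gaussian[OF K f, of "\<lambda>_. 0" 0 "\<lambda>_. 0"]])
        (auto simp: norm_mult)
    fix w :: "'i \<Rightarrow> real"
    define \<eta> where "\<eta> i = w i / (2 * pi)" for i
    have "bargmann K f (\<lambda>i. of_real 0 + s * of_real (\<eta> i)) = 0" for s
    proof (rule entire_zero_if_zero_on_reals[of "\<lambda>s. bargmann K f (\<lambda>i. of_real 0 + s * of_real (\<eta> i))"])
      show "bargmann K f (\<lambda>i. of_real 0 + of_real x * of_real (\<eta> i)) = 0" for x
        using zero[of "\<lambda>i. x * \<eta> i"] by simp
    qed (rule bargmann_line_holomorphic[OF K f])
    from this[of \<i>] have "bargmann K f (\<lambda>i. \<i> * of_real (\<eta> i)) = 0" by simp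
    moreover have "f t * exp (\<Sum>i\<in>K. - of_real pi * (of_real (t i))\<^sup>2 + 2 * of_real pi * of_real (t i) * (\<i> * of_real (\<eta> i)))
       = ?\<phi> t * cis (\<Sum>i\<in>K. w i * t i)" for t
      unfolding exp_of_real[symmetric] cis_conv_exp mult.assoc exp_add[symmetric]
      by (simp add: sum_distrib_left sum.distrib[symmetric] \<eta>_def mult_ac)
    ultimately show "(LINT t|lborel_on K. ?\<phi> t * cis (\<Sum>i\<in>K. w i * t i)) = 0"
      by (simp only: bargmann_def)
  qed
  then show ?thesis by eventually_elim simp
qed

section \<open>Gaussian averages of the short-time Fourier transform\<close>

text \<open>
  With \<open>q = x - \<i> w\<close> the exponent is \<open>\<pi>\<close> times \<open>\<i> x w + \<zeta> \<zeta>' - \<bar>q\<bar>\<^sup>2/2 - \<zeta> q + \<zeta>' cnj q\<close>, summed over the coordinates: the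
  phase that makes the short-time Fourier transform symmetric, times a Gaussian, times an exponential
  that shifts the Gaussian to complex parameters.
\<close>

definition STFT_kernel :: "'i set \<Rightarrow> ('i \<Rightarrow> complex) \<Rightarrow> ('i \<Rightarrow> complex) \<Rightarrow> ('i \<Rightarrow> real) \<Rightarrow> ('i \<Rightarrow> real) \<Rightarrow> complex" where
  "STFT_kernel K \<zeta> \<zeta>' x w = exp (\<Sum>i\<in>K. \<i> * of_real pi * of_real (x i) * of_real (w i) + of_real pi * \<zeta> i * \<zeta>' i
          - (of_real pi / 2) * ((of_real (x i))\<^sup>2 + (of_real (w i))\<^sup>2)
          - of_real pi * \<zeta> i * (of_real (x i) - \<i> * of_real (w i))
          + of_real pi * \<zeta>' i * (of_real (x i) + \<i> * of_real (w i)))"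

text \<open>
  The short-time Fourier transform of \<open>f\<close> and \<open>g\<close>, integrated against a Gaussian with complex parameters,
  factors into a product of Bargmann transforms of \<open>f\<close> and of the conjugate of \<open>g\<close>. Indeed the Gaussian integral
  over the frequency \<open>w\<close> leaves \<open>exp (- \<pi>/2 (x + \<zeta> + \<zeta>' - 2t)\<^sup>2)\<close>; with \<open>x = t - s\<close> this combines with
  \<open>exp (- \<pi>/2 x\<^sup>2)\<close> into a function of \<open>t\<close> times a function of \<open>s\<close>. The point of the lemma is that decay of the
  short-time Fourier transform becomes a growth bound for a product of two entire functions.
\<close>

lemma STFT_Gaussian_integral_eq_bargmann:
  fixes \<zeta> \<zeta>' :: "'i \<Rightarrow> complex"
  assumes K: "finite K" and f: "square_integrable_on K f" and g: "square_integrable_on K g"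
  shows "(LINT z|(lborel_on K \<Otimes>\<^sub>M lborel_on K). STFT_on K g f (fst z) (snd z)
      * STFT_kernel K \<zeta> \<zeta>' (fst z) (snd z))
    = of_real (sqrt 2 ^ card K) * exp (\<Sum>i\<in>K. - (of_real pi / 2) * ((\<zeta> i)\<^sup>2 + (\<zeta>' i)\<^sup>2))
        * bargmann K f \<zeta>' * bargmann K (\<lambda>t. cnj (g t)) \<zeta>"
proof -
  let ?M = "lborel_on K"
  have [measurable]: "f \<in> borel_measurable ?M" "g \<in> borel_measurable ?M"
    and f2: "integrable ?M (\<lambda>t. (norm (f t))\<^sup>2)" and g2: "integrable ?M (\<lambda>t. (norm (g t))\<^sup>2)"
    using f g by (auto simp: square_integrable_on_def)
  interpret M: sigma_finite_measure ?M by (rule sigma_finite_lborel_on[OF K])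
  interpret MM: pair_sigma_finite ?M ?M ..
  interpret MMM: pair_sigma_finite "?M \<Otimes>\<^sub>M ?M" ?M ..
  define T where "T t x = (\<lambda>i\<in>K. t i - x i)" for t x :: "'i \<Rightarrow> real"
  have T_meas [measurable (raw)]: "(\<lambda>z. T (h1 z) (h2 z)) \<in> measurable N ?M"
    if "h1 \<in> measurable N ?M" "h2 \<in> measurable N ?M" for h1 h2 N
    unfolding T_def using that by measurable
  define p where "p x = (\<Sum>i\<in>K. of_real pi * \<zeta> i * \<zeta>' i - (of_real pi / 2) * (of_real (x i))\<^sup>2
      - of_real pi * \<zeta> i * of_real (x i) + of_real pi * \<zeta>' i * of_real (x i))" for x :: "'i \<Rightarrow> real"
  define c where "c t x i = (\<i> / 2) * (of_real (x i) + \<zeta> i + \<zeta>' i - 2 * of_real (t i))" for t x :: "'i \<Rightarrow> real" and i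
  define q where "q t x w = (\<Sum>i\<in>K. - (of_real pi / 2) * (of_real (w i))\<^sup>2 + 2 * of_real pi * c t x i * of_real (w i))" for t x w :: "'i \<Rightarrow> real"
  define E where "E z t = f t * cnj (g (T t (fst z))) * exp (p (fst z)) * exp (q t (fst z) (snd z))" for z t
  have [measurable (raw)]: "(\<lambda>z. p (h z)) \<in> borel_measurable N" if [measurable]: "h \<in> measurable N ?M" for h N
    unfolding p_def by measurable
  have [measurable (raw)]: "(\<lambda>z. q (h1 z) (h2 z) (h3 z)) \<in> borel_measurable N"
    if [measurable]: "h1 \<in> measurable N ?M" "h2 \<in> measurable N ?M" "h3 \<in> measurable N ?M" for h1 h2 h3 N
    unfolding q_def c_def by measurable
  have E_meas [measurable]: "(\<lambda>(z, t). E z t) \<in> borel_measurable ((?M \<Otimes>\<^sub>M ?M) \<Otimes>\<^sub>M ?M)"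
    unfolding E_def by measurable

  define P where "P x = exp (Re (p x))" for x
  define W where "W w = exp (\<Sum>i\<in>K. - (pi / 2) * (w i)\<^sup>2 + (- pi * Im (\<zeta> i + \<zeta>' i)) * w i)" for w
  have P: "integrable ?M P"
  proof -
    have "integrable ?M (\<lambda>x. exp (\<Sum>i\<in>K. pi * Re (\<zeta> i * \<zeta>' i)) * exp (\<Sum>i\<in>K. - (pi / 2) * (x i)\<^sup>2 + (pi * Re (\<zeta>' i - \<zeta> i)) * x i))"
      by (intro integrable_mult_right integrable_product_Gaussian_linear[OF K]) auto
    moreover have P_eq: "P x = exp (\<Sum>i\<in>K. pi * Re (\<zeta> i * \<zeta>' i)) * exp (\<Sum>i\<in>K. - (pi / 2) * (x i)\<^sup>2 + (pi * Re (\<zeta>' i - \<zeta> i)) * x i)" for x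
      unfolding P_def p_def exp_add[symmetric]
      by (simp add: sum.distrib[symmetric] algebra_simps power2_eq_square)
    ultimately show ?thesis by (subst Bochner_Integration.integrable_cong[OF refl P_eq])
  qed
  have W: "integrable ?M W"
    unfolding W_def by (rule integrable_product_Gaussian_linear[OF K]) simp
  have [measurable]: "P \<in> borel_measurable ?M" "W \<in> borel_measurable ?M" using P W by auto
  have norm_E: "norm (E z t) = norm (f t) * norm (g (T t (fst z))) * P (fst z) * W (snd z)" for z t
  proof -
    have "Re (q t x w) = (\<Sum>i\<in>K. - (pi / 2) * (w i)\<^sup>2 + (- pi * Im (\<zeta> i + \<zeta>' i)) * w i)" for x w
      unfolding q_def c_def by (simp add: algebra_simps power2_eq_square)
    then show ?thesis by (simp add: E_def norm_mult P_def W_def)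
  qed
  \<comment> \<open>Translation invariance bounds the inner integral over \<open>t\<close> independently of \<open>x\<close>, and the rest is Gaussian.\<close>
  define C where "C = (\<integral>\<^sup>+ t. (norm (f t))\<^sup>2 \<partial>?M) + (\<integral>\<^sup>+ t. (norm (g t))\<^sup>2 \<partial>?M)"
  have C: "C < \<infinity>"
    using f2 g2 by (auto simp: C_def integrable_iff_bounded)
  have fg_le: "(\<integral>\<^sup>+ t. norm (f t) * norm (g (T t x)) \<partial>?M) \<le> C" if x: "x \<in> space ?M" for x
  proof -
    have [measurable]: "(\<lambda>t. T t x) \<in> measurable ?M ?M"
      using x by measurable
    have "(\<integral>\<^sup>+ t. norm (f t) * norm (g (T t x)) \<partial>?M) \<le> (\<integral>\<^sup>+ t. (norm (f t))\<^sup>2 + (norm (g (T t x)))\<^sup>2 \<partial>?M)"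
    proof (intro nn_integral_mono ennreal_leI)
      fix t
      have "0 \<le> norm (f t) * norm (g (T t x))" by simp
      moreover have "2 * (norm (f t) * norm (g (T t x))) \<le> (norm (f t))\<^sup>2 + (norm (g (T t x)))\<^sup>2"
        using sum_squares_bound[of "norm (f t)" "norm (g (T t x))"] by simp
      ultimately show "norm (f t) * norm (g (T t x)) \<le> (norm (f t))\<^sup>2 + (norm (g (T t x)))\<^sup>2" by linarith
    qed
    also have "\<dots> = (\<integral>\<^sup>+ t. (norm (f t))\<^sup>2 \<partial>?M) + (\<integral>\<^sup>+ t. (norm (g (T t x)))\<^sup>2 \<partial>?M)"
      by (subst nn_integral_add[symmetric]) auto
    also have "(\<integral>\<^sup>+ t. (norm (g (T t x)))\<^sup>2 \<partial>?M) = (\<integral>\<^sup>+ t. (norm (g t))\<^sup>2 \<partial>distr ?M ?M (\<lambda>t. T t x))"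
      by (subst nn_integral_distr) auto
    also have "distr ?M ?M (\<lambda>t. T t x) = ?M"
      unfolding T_def by (rule distr_lborel_on_translate[OF K])
    finally show ?thesis unfolding C_def .
  qed
  have E_int: "integrable ((?M \<Otimes>\<^sub>M ?M) \<Otimes>\<^sub>M ?M) (\<lambda>(z, t). E z t)"
  proof -
    have "(\<integral>\<^sup>+ y. norm (case y of (z, t) \<Rightarrow> E z t) \<partial>((?M \<Otimes>\<^sub>M ?M) \<Otimes>\<^sub>M ?M)) = (\<integral>\<^sup>+ z. \<integral>\<^sup>+ t. norm (E z t) \<partial>?M \<partial>(?M \<Otimes>\<^sub>M ?M))"
      by (subst M.nn_integral_fst[symmetric]) auto
    also have "\<dots> \<le> (\<integral>\<^sup>+ z. C * (P (fst z) * W (snd z)) \<partial>(?M \<Otimes>\<^sub>M ?M))"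
    proof (rule nn_integral_mono)
      fix z assume z: "z \<in> space (?M \<Otimes>\<^sub>M ?M)"
      then have x: "fst z \<in> space ?M" by (auto simp: space_pair_measure)
      have [measurable]: "(\<lambda>t. T t (fst z)) \<in> measurable ?M ?M"
        using x by measurable
      have "(\<integral>\<^sup>+ t. norm (E z t) \<partial>?M) = (\<integral>\<^sup>+ t. ennreal (norm (f t) * norm (g (T t (fst z)))) * ennreal (P (fst z) * W (snd z)) \<partial>?M)"
        unfolding norm_E by (intro nn_integral_cong) (auto simp: ennreal_mult[symmetric] P_def W_def mult.assoc)
      also have "\<dots> = (\<integral>\<^sup>+ t. ennreal (norm (f t) * norm (g (T t (fst z)))) \<partial>?M) * ennreal (P (fst z) * W (snd z))"
        by (rule nn_integral_multc) auto
      also have "\<dots> \<le> C * ennreal (P (fst z) * W (snd z))"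
        by (intro mult_right_mono fg_le x) auto
      finally show "(\<integral>\<^sup>+ t. norm (E z t) \<partial>?M) \<le> C * (P (fst z) * W (snd z))" .
    qed
    also have "\<dots> = C * ((\<integral>\<^sup>+ x. P x \<partial>?M) * (\<integral>\<^sup>+ w. W w \<partial>?M))"
    proof -
      have "(\<integral>\<^sup>+ z. P (fst z) * W (snd z) \<partial>(?M \<Otimes>\<^sub>M ?M)) = (\<integral>\<^sup>+ x. \<integral>\<^sup>+ w. ennreal (P x) * ennreal (W w) \<partial>?M \<partial>?M)"
        by (subst M.nn_integral_fst[symmetric]) (auto simp: ennreal_mult[symmetric] P_def W_def)
      also have "\<dots> = (\<integral>\<^sup>+ x. P x \<partial>?M) * (\<integral>\<^sup>+ w. W w \<partial>?M)"
        by (simp add: nn_integral_cmult nn_integral_multc)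
      finally show ?thesis by (subst nn_integral_cmult) auto
    qed
    also have "\<dots> < \<infinity>"
    proof -
      have "(\<integral>\<^sup>+ x. P x \<partial>?M) < \<infinity>" "(\<integral>\<^sup>+ w. W w \<partial>?M) < \<infinity>"
        using P W by (auto simp: integrable_iff_bounded P_def W_def)
      then show ?thesis using C by (simp add: ennreal_mult_less_top)
    qed
    finally show ?thesis by (intro integrableI_bounded) auto
  qed

  \<comment> \<open>The phases and the kernel regroup into a function of \<open>x\<close> and a Gaussian in \<open>w\<close>.\<close>
  have split: "STFT_on K g f (fst z) (snd z)
      * STFT_kernel K \<zeta> \<zeta>' (fst z) (snd z)
      = (LINT t|?M. E z t)" for z
  proof -
    have e: "cis (- 2 * pi * (\<Sum>i\<in>K. t i * snd z i)) * STFT_kernel K \<zeta> \<zeta>' (fst z) (snd z)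
       = exp (p (fst z)) * exp (q t (fst z) (snd z))" for t
    proof -
      have "- (2 * pi) * (t i * snd z i) * \<i> + (\<i> * of_real pi * of_real (fst z i) * of_real (snd z i) + of_real pi * \<zeta> i * \<zeta>' i
          - (of_real pi / 2) * ((of_real (fst z i))\<^sup>2 + (of_real (snd z i))\<^sup>2)
          - of_real pi * \<zeta> i * (of_real (fst z i) - \<i> * of_real (snd z i))
          + of_real pi * \<zeta>' i * (of_real (fst z i) + \<i> * of_real (snd z i)))
         = (of_real pi * \<zeta> i * \<zeta>' i - (of_real pi / 2) * (of_real (fst z i))\<^sup>2
      - of_real pi * \<zeta> i * of_real (fst z i) + of_real pi * \<zeta>' i * of_real (fst z i))
        + (- (of_real pi / 2) * (of_real (snd z i))\<^sup>2 + 2 * of_real pi * c t (fst z) i * of_real (snd z i))" for i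
        unfolding c_def by (simp add: field_simps)
      moreover have "\<i> * of_real (- 2 * pi * (\<Sum>i\<in>K. t i * snd z i)) = (\<Sum>i\<in>K. - (2 * pi) * (t i * snd z i) * \<i>)"
        by (simp add: sum_distrib_left sum_distrib_right mult_ac)
      ultimately show ?thesis
        unfolding STFT_kernel_def cis_conv_exp exp_add[symmetric] p_def q_def by (simp only: sum.distrib[symmetric])
    qed
    have "f t * cnj (g (\<lambda>i\<in>K. t i - fst z i)) * cis (- 2 * pi * (\<Sum>i\<in>K. t i * snd z i)) * STFT_kernel K \<zeta> \<zeta>' (fst z) (snd z)
        = E z t" for t
      unfolding E_def T_def by (simp only: mult.assoc[of "f t * cnj (g (\<lambda>i\<in>K. t i - fst z i))"] e)
    then show ?thesis
      unfolding STFT_on_def by (subst integral_mult_left_zero[symmetric]) (simp only:)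
  qed

  define k where "k = of_real (sqrt 2 ^ card K) * exp (\<Sum>i\<in>K. - (of_real pi / 2) * ((\<zeta> i)\<^sup>2 + (\<zeta>' i)\<^sup>2))"
  have inner: "(LINT z|(?M \<Otimes>\<^sub>M ?M). E z t) = k * (f t * exp (\<Sum>i\<in>K. - of_real pi * (of_real (t i))\<^sup>2 + 2 * of_real pi * of_real (t i) * \<zeta>' i))
        * bargmann K (\<lambda>t. cnj (g t)) \<zeta>"
    if int: "integrable (?M \<Otimes>\<^sub>M ?M) (\<lambda>z. E z t)" and t: "t \<in> space ?M" for t
  proof -
    have "(LINT z|(?M \<Otimes>\<^sub>M ?M). E z t) = (LINT x|?M. LINT w|?M. E (x, w) t)"
      using MM.integral_fst'[OF int] by simp
    also have "\<dots> = (LINT x|?M. of_real (sqrt 2 ^ card K) * f t * cnj (g (T t x)) * exp (p x + (\<Sum>i\<in>K. 2 * of_real pi * (c t x i)\<^sup>2)))"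
      unfolding E_def fst_conv snd_conv q_def exp_add
      by (subst integral_mult_right_zero) (simp only: product_Gaussian_integral[OF K], simp only: mult_ac)
    \<comment> \<open>the substitution \<open>x = t - s\<close>, under which the measure is invariant\<close>
    also have "\<dots> = (LINT x|distr ?M ?M (T t). of_real (sqrt 2 ^ card K) * f t * cnj (g (T t x)) * exp (p x + (\<Sum>i\<in>K. 2 * of_real pi * (c t x i)\<^sup>2)))"
      unfolding T_def by (subst distr_lborel_on_reflect_translate[OF K]) (rule refl)
    also have "\<dots> = (LINT s|?M. of_real (sqrt 2 ^ card K) * f t * cnj (g (T t (T t s))) * exp (p (T t s) + (\<Sum>i\<in>K. 2 * of_real pi * (c t (T t s) i)\<^sup>2)))"
    proof (subst integral_distr)
      show "T t \<in> measurable ?M ?M" using t by measurable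
      show "(\<lambda>x. of_real (sqrt 2 ^ card K) * f t * cnj (g (T t x)) * exp (p x + (\<Sum>i\<in>K. 2 * of_real pi * (c t x i)\<^sup>2))) \<in> borel_measurable ?M"
        using t unfolding c_def by measurable
    qed (rule refl)
    also have "\<dots> = (LINT s|?M. (k * (f t * exp (\<Sum>i\<in>K. - of_real pi * (of_real (t i))\<^sup>2 + 2 * of_real pi * of_real (t i) * \<zeta>' i))) * (cnj (g s) * exp (\<Sum>i\<in>K. - of_real pi * (of_real (s i))\<^sup>2 + 2 * of_real pi * of_real (s i) * \<zeta> i)))"
    proof (rule Bochner_Integration.integral_cong[OF refl])
      fix s assume s: "s \<in> space ?M"
      have "T t (T t s) = restrict s K" by (auto simp: T_def)
      then have TT: "T t (T t s) = s" using restrict_eq_on_space[OF s] by simp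
      have "p (T t s) + (\<Sum>i\<in>K. 2 * of_real pi * (c t (T t s) i)\<^sup>2)
          = (\<Sum>i\<in>K. - (of_real pi / 2) * ((\<zeta> i)\<^sup>2 + (\<zeta>' i)\<^sup>2))
            + ((\<Sum>i\<in>K. - of_real pi * (of_real (t i))\<^sup>2 + 2 * of_real pi * of_real (t i) * \<zeta>' i)
            + (\<Sum>i\<in>K. - of_real pi * (of_real (s i))\<^sup>2 + 2 * of_real pi * of_real (s i) * \<zeta> i))"
        unfolding p_def sum.distrib[symmetric]
      proof (rule sum.cong[OF refl])
        fix i assume "i \<in> K"
        then have Ti: "T t s i = t i - s i" by (simp add: T_def)
        have "c t (T t s) i = (\<i> / 2) * (\<zeta> i + \<zeta>' i - of_real (t i) - of_real (s i))"
          by (simp add: c_def Ti)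
        then have c2: "(c t (T t s) i)\<^sup>2 = - (1/4) * (\<zeta> i + \<zeta>' i - of_real (t i) - of_real (s i))\<^sup>2"
          by (simp only: power_mult_distrib) (simp add: power_divide)
        show "of_real pi * \<zeta> i * \<zeta>' i - (of_real pi / 2) * (of_real (T t s i))\<^sup>2
          - of_real pi * \<zeta> i * of_real (T t s i) + of_real pi * \<zeta>' i * of_real (T t s i)
          + 2 * of_real pi * (c t (T t s) i)\<^sup>2
          = - (of_real pi / 2) * ((\<zeta> i)\<^sup>2 + (\<zeta>' i)\<^sup>2)
            + ((- of_real pi * (of_real (t i))\<^sup>2 + 2 * of_real pi * of_real (t i) * \<zeta>' i)
            + (- of_real pi * (of_real (s i))\<^sup>2 + 2 * of_real pi * of_real (s i) * \<zeta> i))"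
          unfolding Ti c2 by (simp add: field_simps power2_eq_square)
      qed
      then show "of_real (sqrt 2 ^ card K) * f t * cnj (g (T t (T t s))) * exp (p (T t s) + (\<Sum>i\<in>K. 2 * of_real pi * (c t (T t s) i)\<^sup>2))
        = (k * (f t * exp (\<Sum>i\<in>K. - of_real pi * (of_real (t i))\<^sup>2 + 2 * of_real pi * of_real (t i) * \<zeta>' i))) * (cnj (g s) * exp (\<Sum>i\<in>K. - of_real pi * (of_real (s i))\<^sup>2 + 2 * of_real pi * of_real (s i) * \<zeta> i))"
        unfolding TT by (simp only: exp_add k_def mult_ac)
    qed
    finally show ?thesis by (simp only: integral_mult_right_zero bargmann_def)
  qed
  have AE_int: "AE t in ?M. integrable (?M \<Otimes>\<^sub>M ?M) (\<lambda>z. E z t)"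
    by (rule MMM.AE_integrable_snd[OF E_int])
  have "(LINT z|(?M \<Otimes>\<^sub>M ?M). LINT t|?M. E z t) = (LINT t|?M. LINT z|(?M \<Otimes>\<^sub>M ?M). E z t)"
    by (rule MMM.Fubini_integral[symmetric, OF E_int])
  also have "\<dots> = (LINT t|?M. k * (f t * exp (\<Sum>i\<in>K. - of_real pi * (of_real (t i))\<^sup>2 + 2 * of_real pi * of_real (t i) * \<zeta>' i))
        * bargmann K (\<lambda>t. cnj (g t)) \<zeta>)"
  proof (rule integral_cong_AE)
    show "AE t in ?M. (LINT z|(?M \<Otimes>\<^sub>M ?M). E z t) = k * (f t * exp (\<Sum>i\<in>K. - of_real pi * (of_real (t i))\<^sup>2 + 2 * of_real pi * of_real (t i) * \<zeta>' i))
        * bargmann K (\<lambda>t. cnj (g t)) \<zeta>"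
      using AE_int AE_space by eventually_elim (rule inner)
    show "(\<lambda>t. LINT z|(?M \<Otimes>\<^sub>M ?M). E z t) \<in> borel_measurable ?M"
      using MMM.integrable_snd[OF E_int] by auto
  qed measurable
  also have "\<dots> = k * bargmann K f \<zeta>' * bargmann K (\<lambda>t. cnj (g t)) \<zeta>"
    by (simp only: integral_mult_right_zero integral_mult_left_zero bargmann_def)
  finally show ?thesis unfolding split k_def .
qed

section \<open>Beurling's theorem for the short-time Fourier transform\<close>

text \<open>
  Completing the square. Up to the first summand, which does not depend on \<open>x\<close> and \<open>w\<close>, the kernel is dominated by
  exactly the weight \<open>exp (\<pi> \<bar>x \<bullet> w\<bar>)\<close> of Beurling's condition. The choice \<open>\<zeta>' = \<plusminus>\<i> \<zeta>\<close> is the one for which the first summand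
  vanishes along a whole diagonal of the \<open>s\<close>-plane.
\<close>

lemma norm_STFT_kernel_i:
  fixes \<eta> :: "'i \<Rightarrow> real"
  shows "norm (STFT_kernel K (\<lambda>i. s * of_real (\<eta> i)) (\<lambda>i. \<i> * s * of_real (\<eta> i)) x w)
    = exp (pi / 2 * (Re s - Im s)\<^sup>2 * (\<Sum>i\<in>K. (\<eta> i)\<^sup>2) + pi * (\<Sum>i\<in>K. x i * w i)
        - pi / 2 * (\<Sum>i\<in>K. (x i + w i + (Re s + Im s) * \<eta> i)\<^sup>2))"
proof -
  have "Re (\<i> * of_real pi * of_real (x i) * of_real (w i) + of_real pi * (s * of_real (\<eta> i)) * (\<i> * s * of_real (\<eta> i))
          - (of_real pi / 2) * ((of_real (x i))\<^sup>2 + (of_real (w i))\<^sup>2)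
          - of_real pi * (s * of_real (\<eta> i)) * (of_real (x i) - \<i> * of_real (w i))
          + of_real pi * (\<i> * s * of_real (\<eta> i)) * (of_real (x i) + \<i> * of_real (w i)))
      = pi / 2 * (Re s - Im s)\<^sup>2 * (\<eta> i)\<^sup>2 + pi * (x i * w i) - pi / 2 * (x i + w i + (Re s + Im s) * \<eta> i)\<^sup>2" for i
    by (simp add: field_simps power2_eq_square)
  then show ?thesis
    unfolding STFT_kernel_def norm_exp_eq_Re Re_sum
    by (simp only: sum.distrib sum_subtractf sum_distrib_left)
qed

text \<open>
  Replacing \<open>w\<close> by \<open>- w\<close> and \<open>s\<close> by its conjugate turns this case into the previous one.
\<close>

lemma norm_STFT_kernel_minus_i:
  fixes \<eta> :: "'i \<Rightarrow> real"
  shows "norm (STFT_kernel K (\<lambda>i. s * of_real (\<eta> i)) (\<lambda>i. - \<i> * s * of_real (\<eta> i)) x w)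
    = exp (pi / 2 * (Re s + Im s)\<^sup>2 * (\<Sum>i\<in>K. (\<eta> i)\<^sup>2) - pi * (\<Sum>i\<in>K. x i * w i)
        - pi / 2 * (\<Sum>i\<in>K. (x i - w i + (Re s - Im s) * \<eta> i)\<^sup>2))"
proof -
  have "Re (\<i> * of_real pi * of_real (x i) * of_real (w i) + of_real pi * (s * of_real (\<eta> i)) * (- \<i> * s * of_real (\<eta> i))
          - (of_real pi / 2) * ((of_real (x i))\<^sup>2 + (of_real (w i))\<^sup>2)
          - of_real pi * (s * of_real (\<eta> i)) * (of_real (x i) - \<i> * of_real (w i))
          + of_real pi * (- \<i> * s * of_real (\<eta> i)) * (of_real (x i) + \<i> * of_real (w i)))
      = pi / 2 * (Re s + Im s)\<^sup>2 * (\<eta> i)\<^sup>2 - pi * (x i * w i) - pi / 2 * (x i - w i + (Re s - Im s) * \<eta> i)\<^sup>2" for i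
    by (simp add: field_simps power2_eq_square)
  then show ?thesis
    unfolding STFT_kernel_def norm_exp_eq_Re Re_sum
    by (simp only: sum.distrib sum_subtractf sum_distrib_left)
qed

lemma measurable_STFT_kernel [measurable (raw)]:
  assumes [measurable]: "h1 \<in> measurable N (lborel_on K)" "h2 \<in> measurable N (lborel_on K)"
  shows "(\<lambda>z. STFT_kernel K \<zeta> \<zeta>' (h1 z) (h2 z)) \<in> borel_measurable N"
  unfolding STFT_kernel_def by measurable

lemma square_integrable_on_cnj:
  "square_integrable_on K g \<Longrightarrow> square_integrable_on K (\<lambda>t. cnj (g t))"
  by (simp add: square_integrable_on_def borel_measurable_complex_cnj)

lemma measurable_STFT_on:
  assumes K: "finite K" and [measurable]: "f \<in> borel_measurable (lborel_on K)" "g \<in> borel_measurable (lborel_on K)"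
  shows "(\<lambda>z. STFT_on K g f (fst z) (snd z)) \<in> borel_measurable (lborel_on K \<Otimes>\<^sub>M lborel_on K)"
proof -
  interpret sigma_finite_measure "lborel_on K" by (rule sigma_finite_lborel_on[OF K])
  show ?thesis
    unfolding STFT_on_def cis_conv_exp by (rule borel_measurable_lebesgue_integral) measurable
qed

text \<open>
  Write \<open>F s\<close> and \<open>G s\<close> for the Bargmann transforms at \<open>s \<eta>\<close>. Integrating against the kernel controls \<open>F (\<i> s) G s\<close>
  near one diagonal of the complex plane and \<open>F (- \<i> s) G s\<close> near the other. The symmetric product
  \<open>Q s = F (\<i> s) F (- \<i> s) G s G (- s)\<close> is controlled near both, since its factors can be paired in two ways. Hence
  \<open>Q\<close> is constant. Along a diagonal the kernel divided by the weight tends to zero pointwise, so the integrability of the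
  weighted transform makes the constant zero; if \<open>f\<close> and \<open>g\<close> are the
  Gaussian \<open>exp (- \<pi> \<bar>t\<bar>\<^sup>2)\<close>, the weighted transform is bounded and \<open>Q\<close> is a nonzero constant.
\<close>

lemma Beurling_STFT_bargmann_dichotomy:
  fixes f g :: "('i \<Rightarrow> real) \<Rightarrow> complex" and \<eta> :: "'i \<Rightarrow> real"
  assumes K: "finite K" and f: "square_integrable_on K f" and g: "square_integrable_on K g"
    and int: "integrable (lborel_on K \<Otimes>\<^sub>M lborel_on K)
      (\<lambda>z. norm (STFT_on K g f (fst z) (snd z)) * exp (pi * \<bar>\<Sum>i\<in>K. fst z i * snd z i\<bar>))"
    and j: "j \<in> K" "\<eta> j \<noteq> 0"
  shows "(\<forall>s. bargmann K f (\<lambda>i. s * of_real (\<eta> i)) = 0) \<or> (\<forall>s. bargmann K (\<lambda>t. cnj (g t)) (\<lambda>i. s * of_real (\<eta> i)) = 0)"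
proof -
  let ?M = "lborel_on K"
  let ?g = "\<lambda>t. cnj (g t)"
  have [measurable]: "f \<in> borel_measurable ?M" "g \<in> borel_measurable ?M"
    using f g by (auto simp: square_integrable_on_def)
  note [measurable] = measurable_STFT_on[OF K, of f g]
  define V where "V z = STFT_on K g f (fst z) (snd z)" for z
  have [measurable]: "V \<in> borel_measurable (?M \<Otimes>\<^sub>M ?M)"
    unfolding V_def[abs_def] by measurable
  define D where "D z = norm (V z) * exp (pi * \<bar>\<Sum>i\<in>K. fst z i * snd z i\<bar>)" for z
  have D: "integrable (?M \<Otimes>\<^sub>M ?M) D" using int by (simp add: D_def[abs_def] V_def)
  define I where "I = (LINT z|(?M \<Otimes>\<^sub>M ?M). D z)"
  define F where "F s = bargmann K f (\<lambda>i. s * of_real (\<eta> i))" for s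
  define G where "G s = bargmann K ?g (\<lambda>i. s * of_real (\<eta> i))" for s
  define N where "N = (\<Sum>i\<in>K. (\<eta> i)\<^sup>2)"
  have N: "N \<ge> 0" by (simp add: N_def sum_nonneg)
  have I: "I \<ge> 0" unfolding I_def D_def by (intro integral_nonneg_AE) auto
  have holF: "F holomorphic_on UNIV" and holG: "G holomorphic_on UNIV"
    using bargmann_line_holomorphic[OF K f, of "\<lambda>_. 0" \<eta>]
      bargmann_line_holomorphic[OF K square_integrable_on_cnj[OF g], of "\<lambda>_. 0" \<eta>]
    by (simp_all add: F_def[abs_def] G_def[abs_def])
  have sqrt2: "1 \<le> sqrt 2 ^ card K" by simp

  have le_norm: "norm (F (\<theta> * s) * G s) \<le> norm (LINT z|(?M \<Otimes>\<^sub>M ?M). V z * STFT_kernel K (\<lambda>i. s * of_real (\<eta> i)) (\<lambda>i. \<theta> * s * of_real (\<eta> i)) (fst z) (snd z))"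
    if \<theta>: "\<theta>\<^sup>2 = -1" for \<theta> s
  proof -
    have "(\<Sum>i\<in>K. - (of_real pi / 2) * ((s * of_real (\<eta> i))\<^sup>2 + (\<theta> * s * of_real (\<eta> i))\<^sup>2)) = 0"
      using \<theta> by (intro sum.neutral) (simp add: power_mult_distrib)
    then have "(LINT z|(?M \<Otimes>\<^sub>M ?M). V z * STFT_kernel K (\<lambda>i. s * of_real (\<eta> i)) (\<lambda>i. \<theta> * s * of_real (\<eta> i)) (fst z) (snd z))
        = of_real (sqrt 2 ^ card K) * (F (\<theta> * s) * G s)"
      unfolding V_def STFT_Gaussian_integral_eq_bargmann[OF K f g] F_def G_def by simp
    then show ?thesis
      using mult_right_mono[OF sqrt2, of "norm (F (\<theta> * s) * G s)"] by (simp add: norm_mult norm_power)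
  qed
  have le_I: "norm (F (\<theta> * s) * G s) \<le> I * exp B"
    if \<theta>: "\<theta>\<^sup>2 = -1"
      and kern: "\<And>x w. norm (STFT_kernel K (\<lambda>i. s * of_real (\<eta> i)) (\<lambda>i. \<theta> * s * of_real (\<eta> i)) x w)
        \<le> exp (pi * \<bar>\<Sum>i\<in>K. x i * w i\<bar> + B)" for \<theta> s B
  proof -
    have "norm (F (\<theta> * s) * G s) \<le> (LINT z|(?M \<Otimes>\<^sub>M ?M). norm (V z * STFT_kernel K (\<lambda>i. s * of_real (\<eta> i)) (\<lambda>i. \<theta> * s * of_real (\<eta> i)) (fst z) (snd z)))"
      by (rule order_trans[OF le_norm[OF \<theta>] integral_norm_bound])
    also have "\<dots> \<le> (LINT z|(?M \<Otimes>\<^sub>M ?M). D z * exp B)"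
    proof (rule integral_mono')
      show "norm (V z * STFT_kernel K (\<lambda>i. s * of_real (\<eta> i)) (\<lambda>i. \<theta> * s * of_real (\<eta> i)) (fst z) (snd z)) \<le> D z * exp B" for z
        unfolding D_def norm_mult mult.assoc[of "norm (V z)"] exp_add[symmetric] by (intro mult_left_mono kern) simp
      show "0 \<le> D z * exp B" for z by (simp add: D_def)
    qed (use D in auto)
    finally show ?thesis by (simp add: I_def)
  qed
  have upper: "norm (F (\<i> * s) * G s) \<le> I * exp (pi / 2 * N * (Re s - Im s)\<^sup>2)" for s
  proof (rule le_I)
    fix x w :: "'i \<Rightarrow> real"
    have "0 \<le> pi / 2 * (\<Sum>i\<in>K. (x i + w i + (Re s + Im s) * \<eta> i)\<^sup>2)"
      by (intro mult_nonneg_nonneg sum_nonneg) auto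
    moreover have "pi * (\<Sum>i\<in>K. x i * w i) \<le> pi * \<bar>\<Sum>i\<in>K. x i * w i\<bar>"
      by (intro mult_left_mono) auto
    moreover have "pi / 2 * (Re s - Im s)\<^sup>2 * N = pi / 2 * N * (Re s - Im s)\<^sup>2" by simp
    ultimately show "norm (STFT_kernel K (\<lambda>i. s * of_real (\<eta> i)) (\<lambda>i. \<i> * s * of_real (\<eta> i)) x w)
        \<le> exp (pi * \<bar>\<Sum>i\<in>K. x i * w i\<bar> + pi / 2 * N * (Re s - Im s)\<^sup>2)"
      unfolding norm_STFT_kernel_i N_def[symmetric] exp_le_cancel_iff by linarith
  qed simp
  have lower: "norm (F (- \<i> * s) * G s) \<le> I * exp (pi / 2 * N * (Re s + Im s)\<^sup>2)" for s
  proof (rule le_I)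
    fix x w :: "'i \<Rightarrow> real"
    have "0 \<le> pi / 2 * (\<Sum>i\<in>K. (x i - w i + (Re s - Im s) * \<eta> i)\<^sup>2)"
      by (intro mult_nonneg_nonneg sum_nonneg) auto
    moreover have "pi * - (\<Sum>i\<in>K. x i * w i) \<le> pi * \<bar>\<Sum>i\<in>K. x i * w i\<bar>"
      by (intro mult_left_mono) auto
    moreover have "pi / 2 * (Re s + Im s)\<^sup>2 * N = pi / 2 * N * (Re s + Im s)\<^sup>2" by simp
    ultimately show "norm (STFT_kernel K (\<lambda>i. s * of_real (\<eta> i)) (\<lambda>i. - \<i> * s * of_real (\<eta> i)) x w)
        \<le> exp (pi * \<bar>\<Sum>i\<in>K. x i * w i\<bar> + pi / 2 * N * (Re s + Im s)\<^sup>2)"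
      unfolding norm_STFT_kernel_minus_i N_def[symmetric] exp_le_cancel_iff by linarith
  qed simp
  define Q where "Q s = (F (\<i> * s) * F (- \<i> * s)) * (G s * G (- s))" for s
  have Q_bound: "norm (Q s) \<le> I\<^sup>2 * exp (pi * N * (\<bar>Re s\<bar> - \<bar>Im s\<bar>)\<^sup>2)" for s
  proof -
    have e: "(I * exp (pi / 2 * N * X)) * (I * exp (pi / 2 * N * X)) = I\<^sup>2 * exp (pi * N * X)" for X
      by (simp add: power2_eq_square exp_add[symmetric] mult_ac)
    show ?thesis
    proof (cases "Re s * Im s \<ge> 0")
      case True
      then have "(\<bar>Re s\<bar> - \<bar>Im s\<bar>)\<^sup>2 = (Re s - Im s)\<^sup>2"
        by (simp add: power2_diff abs_mult[symmetric] mult.assoc)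
      moreover have "norm (F (\<i> * s) * G s) * norm (F (- \<i> * s) * G (- s)) \<le> (I * exp (pi / 2 * N * (Re s - Im s)\<^sup>2)) * (I * exp (pi / 2 * N * (Re s - Im s)\<^sup>2))"
        using upper[of s] upper[of "- s"] I by (intro mult_mono) (auto simp: power2_commute)
      ultimately show ?thesis
        unfolding e by (simp add: Q_def norm_mult mult_ac)
    next
      case False
      then have "(\<bar>Re s\<bar> - \<bar>Im s\<bar>)\<^sup>2 = (Re s + Im s)\<^sup>2"
        by (simp add: power2_diff power2_sum abs_mult[symmetric] mult.assoc)
      moreover have "norm (F (- \<i> * s) * G s) * norm (F (\<i> * s) * G (- s)) \<le> (I * exp (pi / 2 * N * (Re s + Im s)\<^sup>2)) * (I * exp (pi / 2 * N * (Re s + Im s)\<^sup>2))"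
        using lower[of s] lower[of "- s"] I by (intro mult_mono) (auto simp: power2_eq_square algebra_simps)
      ultimately show ?thesis
        unfolding e by (simp add: Q_def norm_mult mult_ac)
    qed
  qed
  have hol_scale: "(\<lambda>s. h (c * s)) holomorphic_on UNIV" if "h holomorphic_on UNIV" for h :: "complex \<Rightarrow> complex" and c
    by (intro holomorphic_on_compose_gen[OF _ that, unfolded o_def] holomorphic_intros) auto
  have holF2: "(\<lambda>s. F (\<i> * s) * F (- \<i> * s)) holomorphic_on UNIV"
    and holG2: "(\<lambda>s. G s * G (- s)) holomorphic_on UNIV"
    using hol_scale[OF holF, of \<i>] hol_scale[OF holF, of "- \<i>"] holG hol_scale[OF holG, of "- 1"]
    by (auto intro!: holomorphic_on_mult)
  have holQ: "Q holomorphic_on UNIV"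
    unfolding Q_def[abs_def] by (intro holomorphic_on_mult holF2 holG2)
  have "norm (Q s) \<le> I\<^sup>2" for s
    by (rule bounded_if_bounded_near_diagonals[OF holQ _ _ Q_bound]) (use N in auto)
  then have "bounded (range Q)" by (auto simp: bounded_iff)
  from Liouville_theorem[OF holQ this] obtain q where q: "\<And>s. Q s = q"
    by (auto simp: constant_on_def)

  \<comment> \<open>On the diagonal the first summand in the exponent of the kernel is zero, and the subtracted square goes to infinity.\<close>
  define s where "s n = of_real (real n) * (1 + \<i>)" for n
  define J where "J n = norm (LINT z|(?M \<Otimes>\<^sub>M ?M). V z * STFT_kernel K (\<lambda>i. s n * of_real (\<eta> i)) (\<lambda>i. \<i> * s n * of_real (\<eta> i)) (fst z) (snd z))" for n
  have J: "J \<longlonglongrightarrow> 0"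
  proof -
    have "(\<lambda>n. LINT z|(?M \<Otimes>\<^sub>M ?M). V z * STFT_kernel K (\<lambda>i. s n * of_real (\<eta> i)) (\<lambda>i. \<i> * s n * of_real (\<eta> i)) (fst z) (snd z))
        \<longlonglongrightarrow> (LINT z|(?M \<Otimes>\<^sub>M ?M). 0)"
    proof (rule integral_dominated_convergence[where w = D])
      have kern: "norm (STFT_kernel K (\<lambda>i. s n * of_real (\<eta> i)) (\<lambda>i. \<i> * s n * of_real (\<eta> i)) x w)
          \<le> exp (pi * (\<Sum>i\<in>K. x i * w i)) * exp (- (pi / 2 * (x j + w j + 2 * real n * \<eta> j)\<^sup>2))" for n x w
      proof -
        have "(x j + w j + 2 * real n * \<eta> j)\<^sup>2 \<le> (\<Sum>i\<in>K. (x i + w i + 2 * real n * \<eta> i)\<^sup>2)"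
          using K j by (intro member_le_sum) auto
        then have "pi / 2 * (x j + w j + 2 * real n * \<eta> j)\<^sup>2 \<le> pi / 2 * (\<Sum>i\<in>K. (x i + w i + 2 * real n * \<eta> i)\<^sup>2)"
          by (intro mult_left_mono) auto
        then show ?thesis
          unfolding norm_STFT_kernel_i exp_add[symmetric] exp_le_cancel_iff by (simp add: s_def)
      qed
      show "AE z in ?M \<Otimes>\<^sub>M ?M. norm (V z * STFT_kernel K (\<lambda>i. s n * of_real (\<eta> i)) (\<lambda>i. \<i> * s n * of_real (\<eta> i)) (fst z) (snd z)) \<le> D z" for n
      proof (rule AE_I2)
        fix z
        have "exp (pi * (\<Sum>i\<in>K. fst z i * snd z i)) * exp (- (pi / 2 * (fst z j + snd z j + 2 * real n * \<eta> j)\<^sup>2))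
            \<le> exp (pi * \<bar>\<Sum>i\<in>K. fst z i * snd z i\<bar>) * 1"
          by (intro mult_mono) auto
        then show "norm (V z * STFT_kernel K (\<lambda>i. s n * of_real (\<eta> i)) (\<lambda>i. \<i> * s n * of_real (\<eta> i)) (fst z) (snd z)) \<le> D z"
          unfolding D_def norm_mult using kern[of n "fst z" "snd z"] by (intro mult_left_mono) auto
      qed
      show "AE z in ?M \<Otimes>\<^sub>M ?M. (\<lambda>n. V z * STFT_kernel K (\<lambda>i. s n * of_real (\<eta> i)) (\<lambda>i. \<i> * s n * of_real (\<eta> i)) (fst z) (snd z)) \<longlonglongrightarrow> 0"
      proof (rule AE_I2)
        fix z
        have "(\<lambda>n. exp (- (pi / 2 * (c + 2 * real n * \<eta> j)\<^sup>2))) \<longlonglongrightarrow> 0" for c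
          using j(2) by real_asymp
        from tendsto_mult_right_zero[OF this]
        have "(\<lambda>n. exp (pi * (\<Sum>i\<in>K. fst z i * snd z i)) * exp (- (pi / 2 * (fst z j + snd z j + 2 * real n * \<eta> j)\<^sup>2))) \<longlonglongrightarrow> 0" .
        then have "(\<lambda>n. STFT_kernel K (\<lambda>i. s n * of_real (\<eta> i)) (\<lambda>i. \<i> * s n * of_real (\<eta> i)) (fst z) (snd z)) \<longlonglongrightarrow> 0"
          by (rule Lim_null_comparison[rotated]) (use kern in auto)
        then show "(\<lambda>n. V z * STFT_kernel K (\<lambda>i. s n * of_real (\<eta> i)) (\<lambda>i. \<i> * s n * of_real (\<eta> i)) (fst z) (snd z)) \<longlonglongrightarrow> 0"
          by (rule tendsto_mult_right_zero)
      qed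
    qed (use D in measurable)
    then show ?thesis unfolding J_def by (simp add: tendsto_norm_zero)
  qed
  have "norm q \<le> J n * I" for n
  proof -
    have "norm q = norm (F (\<i> * s n) * G (s n)) * norm (F (\<i> * (- s n)) * G (- s n))"
      unfolding q[of "s n", symmetric] Q_def norm_mult by (simp add: mult_ac)
    also have "\<dots> \<le> J n * I"
    proof (rule mult_mono)
      show "norm (F (\<i> * s n) * G (s n)) \<le> J n" unfolding J_def by (rule le_norm) simp
      show "norm (F (\<i> * (- s n)) * G (- s n)) \<le> I" using upper[of "- s n"] by (simp add: s_def)
    qed (auto simp: J_def)
    finally show ?thesis .
  qed
  then have "norm q \<le> 0"
    using J by (intro tendsto_lowerbound[OF tendsto_mult_left_zero[OF J, of I]]) auto
  then have "q = 0" by simp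
  then have "(F (\<i> * s) * F (- \<i> * s)) * (G s * G (- s)) = 0" for s
    using q[of s] by (simp add: Q_def)
  from entire_mult_eq_zero[OF holF2 holG2 this]
  have "(\<forall>s. F s = 0) \<or> (\<forall>s. G s = 0)"
  proof
    assume "\<forall>s. F (\<i> * s) * F (- \<i> * s) = 0"
    then have "(\<forall>s. F (\<i> * s) = 0) \<or> (\<forall>s. F (- \<i> * s) = 0)"
      using entire_mult_eq_zero[OF hol_scale[OF holF, of \<i>] hol_scale[OF holF, of "- \<i>"]] by blast
    then have "F s = 0" for s
    proof
      assume "\<forall>s. F (\<i> * s) = 0"
      from this[rule_format, of "- \<i> * s"] show "F s = 0" by simp
    next
      assume "\<forall>s. F (- \<i> * s) = 0"
      from this[rule_format, of "\<i> * s"] show "F s = 0" by simp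
    qed
    then show ?thesis by simp
  next
    assume "\<forall>s. G s * G (- s) = 0"
    then have "(\<forall>s. G s = 0) \<or> (\<forall>s. G (- s) = 0)"
      using entire_mult_eq_zero[OF holG hol_scale[OF holG, of "- 1"]] by simp
    then have "G s = 0" for s
      using minus_minus[of s] by metis
    then show ?thesis by simp
  qed
  then show ?thesis unfolding F_def G_def .
qed

text \<open>
  Beurling's theorem for the short-time Fourier transform. On each complexified real line through the origin one of the
  two Bargmann transforms vanishes, a priori depending on the line. Joining a real point where the first does not vanish to
  one where the second does not by a line shows that the choice can be made uniformly.
\<close>

theorem Beurling_STFT:
  fixes f g :: "('i \<Rightarrow> real) \<Rightarrow> complex"
  assumes K: "finite K" "K \<noteq> {}" and f: "square_integrable_on K f" and g: "square_integrable_on K g"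
    and int: "integrable (lborel_on K \<Otimes>\<^sub>M lborel_on K)
      (\<lambda>z. norm (STFT_on K g f (fst z) (snd z)) * exp (pi * \<bar>\<Sum>i\<in>K. fst z i * snd z i\<bar>))"
  shows "(AE t in lborel_on K. f t = 0) \<or> (AE t in lborel_on K. g t = 0)"
proof -
  let ?g = "\<lambda>t. cnj (g t)"
  note g' = square_integrable_on_cnj[OF g]
  note dich = Beurling_STFT_bargmann_dichotomy[OF K(1) f g int]
  have prod0: "bargmann K f (\<lambda>i. of_real (\<eta> i)) * bargmann K ?g (\<lambda>i. of_real (\<eta> i)) = 0" for \<eta> :: "'i \<Rightarrow> real"
  proof (cases "\<exists>j\<in>K. \<eta> j \<noteq> 0")
    case True
    then obtain j where "j \<in> K" "\<eta> j \<noteq> 0" by auto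
    from dich[of j \<eta>, OF this] show ?thesis by (auto dest: spec[of _ 1])
  next
    case False
    from K obtain j where j: "j \<in> K" by auto
    \<comment> \<open>The origin lies on every line, in particular on the one spanned by the constant vector \<open>1\<close>.\<close>
    from False have "bargmann K h (\<lambda>i. of_real (\<eta> i)) = bargmann K h (\<lambda>i. 0 * of_real ((\<lambda>_. 1) i))" for h
      unfolding bargmann_def by simp
    then show ?thesis using dich[of j "\<lambda>_. 1", OF j] by (auto dest: spec[of _ 0])
  qed
  have "(\<forall>\<eta>. bargmann K f (\<lambda>i. of_real (\<eta> i)) = 0) \<or> (\<forall>\<eta>. bargmann K ?g (\<lambda>i. of_real (\<eta> i)) = 0)"
  proof (rule ccontr)
    assume "\<not> ?thesis"
    then obtain \<eta>0 \<eta>1 where \<eta>0: "bargmann K f (\<lambda>i. of_real (\<eta>0 i)) \<noteq> 0"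
      and \<eta>1: "bargmann K ?g (\<lambda>i. of_real (\<eta>1 i)) \<noteq> 0" by auto
    let ?l = "\<lambda>s i. of_real (\<eta>0 i) + s * of_real (\<eta>1 i - \<eta>0 i) :: complex"
    note holf = bargmann_line_holomorphic[OF K(1) f, of \<eta>0 "\<lambda>i. \<eta>1 i - \<eta>0 i"]
    note holg = bargmann_line_holomorphic[OF K(1) g', of \<eta>0 "\<lambda>i. \<eta>1 i - \<eta>0 i"]
    have "bargmann K f (?l s) * bargmann K ?g (?l s) = 0" for s
    proof (rule entire_zero_if_zero_on_reals[where h = "\<lambda>s. bargmann K f (?l s) * bargmann K ?g (?l s)"])
      fix x :: real
      show "bargmann K f (?l (of_real x)) * bargmann K ?g (?l (of_real x)) = 0"
        using prod0[of "\<lambda>i. \<eta>0 i + x * (\<eta>1 i - \<eta>0 i)"] by simp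
    qed (intro holomorphic_on_mult holf holg)
    from entire_mult_eq_zero[OF holf holg this]
    have "bargmann K f (?l 0) = 0 \<or> bargmann K ?g (?l 1) = 0" by blast
    with \<eta>0 \<eta>1 show False by simp
  qed
  then show ?thesis
  proof
    assume "\<forall>\<eta>. bargmann K f (\<lambda>i. of_real (\<eta> i)) = 0"
    then show ?thesis using bargmann_zero_imp_zero[OF K(1) f] by blast
  next
    assume "\<forall>\<eta>. bargmann K ?g (\<lambda>i. of_real (\<eta> i)) = 0"
    then have "AE t in lborel_on K. ?g t = 0" using bargmann_zero_imp_zero[OF K(1) g'] by blast
    then show ?thesis by simp
  qed
qed

section \<open>Linear changes of variables and splitting of coordinates\<close>

lemma nn_integral_lborel_translate:
  fixes h :: "'a::euclidean_space \<Rightarrow> ennreal"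
  assumes [measurable]: "h \<in> borel_measurable borel"
  shows "(\<integral>\<^sup>+ x. h (c + x) \<partial>lborel) = (\<integral>\<^sup>+ x. h x \<partial>lborel)"
proof -
  have "(\<integral>\<^sup>+ x. h (c + x) \<partial>lborel) = (\<integral>\<^sup>+ x. h x \<partial>distr lborel borel ((+) c))"
    by (subst nn_integral_distr) auto
  then show ?thesis by (simp only: lborel_distr_plus)
qed

text \<open>
  A linear bijection changes Lebesgue measure only by a positive factor. The proof is the one of the uniqueness of Haar measure:
  multiply by the measure of a ball, apply Fubini twice and use translation invariance, which identifies the
  factor as \<open>c\<close> below divided by the measure of the ball.
\<close>

lemma nn_integral_linear_finite:
  fixes T :: "'a::euclidean_space \<Rightarrow> 'a" and h :: "'a \<Rightarrow> ennreal"
  assumes T: "linear T" and S: "\<And>y. T (S y) = y" and [measurable]: "h \<in> borel_measurable borel"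
    and fin: "(\<integral>\<^sup>+ x. h (T x) \<partial>lborel) < \<infinity>"
  shows "(\<integral>\<^sup>+ x. h x \<partial>lborel) < \<infinity>"
proof -
  have contT: "continuous_on UNIV T"
    using T by (simp add: linear_continuous_on linear_conv_bounded_linear)
  have [measurable]: "T \<in> borel_measurable borel"
    using contT by (rule borel_measurable_continuous_onI)
  define B :: "'a \<Rightarrow> ennreal" where "B y = indicator (ball 0 1) y" for y
  have B_meas [measurable]: "B \<in> borel_measurable borel"
    unfolding B_def[abs_def] by (intro borel_measurable_indicator) simp
  define c :: ennreal where "c = (\<integral>\<^sup>+ x. B (- T x) \<partial>lborel)"
  have "open ((\<lambda>x. - T x) -` ball 0 1)"
    using contT by (intro open_vimage continuous_on_minus) auto
  moreover have "0 \<in> (\<lambda>x. - T x) -` ball 0 1"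
    using linear_0[OF T] by simp
  ultimately have "\<not> negligible ((\<lambda>x. - T x) -` ball 0 1)"
    using open_not_negligible by blast
  moreover have vim: "(\<lambda>x. - T x) -` ball 0 1 \<in> sets borel"
    using \<open>open _\<close> by simp
  ultimately have "emeasure lborel ((\<lambda>x. - T x) -` ball 0 1) \<noteq> 0"
    by (simp add: negligible_iff_emeasure0)
  moreover have "c = emeasure lborel ((\<lambda>x. - T x) -` ball 0 1)"
  proof -
    have "c = (\<integral>\<^sup>+ x. indicator ((\<lambda>x. - T x) -` ball 0 1) x \<partial>lborel)"
      unfolding c_def B_def by (intro nn_integral_cong) (simp add: indicator_def)
    then show ?thesis using vim by simp
  qed
  ultimately have c: "c \<noteq> 0" by simp
  have "(\<integral>\<^sup>+ x. h (T x) \<partial>lborel) * emeasure lborel (ball (0::'a) 1)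
      = (\<integral>\<^sup>+ x. \<integral>\<^sup>+ y. h (T x) * B y \<partial>lborel \<partial>lborel)"
  proof -
    have "emeasure lborel (ball (0::'a) 1) = (\<integral>\<^sup>+ y. B y \<partial>lborel)"
      unfolding B_def by (subst nn_integral_indicator) auto
    then show ?thesis
      by (subst nn_integral_cmult, measurable) (simp add: nn_integral_multc)
  qed
  also have "\<dots> = (\<integral>\<^sup>+ x. \<integral>\<^sup>+ y. h (T x) * B (- T x + y) \<partial>lborel \<partial>lborel)"
    by (intro nn_integral_cong nn_integral_lborel_translate[symmetric]) measurable
  also have "\<dots> = (\<integral>\<^sup>+ y. \<integral>\<^sup>+ x. h (T x) * B (- T x + y) \<partial>lborel \<partial>lborel)"
    by (rule lborel_pair.Fubini') measurable
  also have "\<dots> = (\<integral>\<^sup>+ y. \<integral>\<^sup>+ x. h (T (S y + x)) * B (- T (S y + x) + y) \<partial>lborel \<partial>lborel)"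
    by (intro nn_integral_cong nn_integral_lborel_translate[symmetric]) measurable
  also have "\<dots> = (\<integral>\<^sup>+ y. \<integral>\<^sup>+ x. h (y + T x) * B (- T x) \<partial>lborel \<partial>lborel)"
    by (simp add: linear_add[OF T] S)
  also have "\<dots> = (\<integral>\<^sup>+ x. \<integral>\<^sup>+ y. h (y + T x) * B (- T x) \<partial>lborel \<partial>lborel)"
    by (rule lborel_pair.Fubini') measurable
  also have "\<dots> = (\<integral>\<^sup>+ x. (\<integral>\<^sup>+ y. h y \<partial>lborel) * B (- T x) \<partial>lborel)"
  proof (intro nn_integral_cong)
    fix x
    have "(\<integral>\<^sup>+ y. h (y + T x) * B (- T x) \<partial>lborel) = (\<integral>\<^sup>+ y. h (T x + y) \<partial>lborel) * B (- T x)"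
      by (subst nn_integral_multc) (auto simp: add.commute)
    then show "(\<integral>\<^sup>+ y. h (y + T x) * B (- T x) \<partial>lborel) = (\<integral>\<^sup>+ y. h y \<partial>lborel) * B (- T x)"
      by (simp add: nn_integral_lborel_translate)
  qed
  also have "\<dots> = (\<integral>\<^sup>+ y. h y \<partial>lborel) * c"
    unfolding c_def by (rule nn_integral_cmult) measurable
  finally have "(\<integral>\<^sup>+ x. h (T x) \<partial>lborel) * emeasure lborel (ball (0::'a) 1) = (\<integral>\<^sup>+ y. h y \<partial>lborel) * c" .
  moreover have "emeasure lborel (ball (0::'a) 1) < \<infinity>"
    using emeasure_bounded_finite[of "ball (0::'a) 1"] by simp
  ultimately have "(\<integral>\<^sup>+ y. h y \<partial>lborel) * c < \<infinity>"
    using fin by (metis ennreal_mult_less_top infinity_ennreal_def)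
  then show ?thesis
    using c by (auto simp: ennreal_mult_less_top)
qed

lemma borel_measurable_vec_lambda [measurable (raw)]:
  fixes h :: "'a \<Rightarrow> 'n::finite \<Rightarrow> real"
  assumes "\<And>i. (\<lambda>z. h z i) \<in> borel_measurable N"
  shows "(\<lambda>z. \<chi> i. h z i) \<in> borel_measurable N"
proof (subst borel_measurable_euclidean_space, intro ballI)
  fix b :: "real ^ 'n" assume "b \<in> Basis"
  then obtain i where "b = axis i 1" by (auto simp: Basis_vec_def)
  then show "(\<lambda>z. (\<chi> i. h z i) \<bullet> b) \<in> borel_measurable N"
    using assms[of i] by (simp add: cart_eq_inner_axis[symmetric])
qed

lemma borel_measurable_vec_component [measurable (raw)]:
  fixes h :: "'a \<Rightarrow> real ^ 'n::finite"
  assumes "h \<in> borel_measurable N"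
  shows "(\<lambda>z. h z $ i) \<in> borel_measurable N"
  unfolding cart_eq_inner_axis using assms by measurable

lemma distr_eq_lborel_cartI:
  fixes \<psi> :: "'a \<Rightarrow> real ^ 'n::finite"
  assumes [measurable]: "\<psi> \<in> borel_measurable N"
    and box: "\<And>l u. (\<And>i. l $ i \<le> u $ i) \<Longrightarrow>
      emeasure N ({z \<in> space N. \<forall>i. \<psi> z $ i \<in> {l $ i <..< u $ i}}) = (\<Prod>i\<in>UNIV. ennreal (u $ i - l $ i))"
  shows "distr N borel \<psi> = lborel"
proof (rule lborel_eqI[symmetric])
  fix l u :: "real ^ 'n" assume "\<And>b. b \<in> Basis \<Longrightarrow> l \<bullet> b \<le> u \<bullet> b"
  then have le: "l $ i \<le> u $ i" for i
    by (simp add: cart_eq_inner_axis)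
  have "emeasure (distr N borel \<psi>) (box l u) = emeasure N (\<psi> -` box l u \<inter> space N)"
    by (rule emeasure_distr) auto
  also have "\<psi> -` box l u \<inter> space N = {z \<in> space N. \<forall>i. \<psi> z $ i \<in> {l $ i <..< u $ i}}"
    by (auto simp: mem_box_cart)
  also have "emeasure N \<dots> = (\<Prod>i\<in>UNIV. ennreal (u $ i - l $ i))"
    by (rule box[OF le])
  also have "\<dots> = ennreal (\<Prod>i\<in>UNIV. u $ i - l $ i)"
    using le by (simp add: prod_ennreal)
  also have "(\<Prod>i\<in>UNIV. u $ i - l $ i) = (\<Prod>b\<in>Basis. (u - l) \<bullet> b)"
  proof -
    have B: "(Basis :: (real ^ 'n) set) = (\<lambda>i. axis i 1) ` UNIV" by (auto simp: Basis_vec_def)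
    show ?thesis
      unfolding B by (subst prod.reindex) (auto simp: inj_on_def axis_eq_axis cart_eq_inner_axis[symmetric])
  qed
  finally show "emeasure (distr N borel \<psi>) (box l u) = ennreal (\<Prod>b\<in>Basis. (u - l) \<bullet> b)" .
qed simp

definition glue :: "'n set \<Rightarrow> ('n \<Rightarrow> real) \<Rightarrow> ('n \<Rightarrow> real) \<Rightarrow> real ^ 'n::finite" where
  "glue K t y = (\<chi> i. if i \<in> K then t i else y i)"

text \<open>
  A point of phase space from its coordinates in \<open>K\<close> and outside \<open>K\<close>, each of the two given as a pair of a position and a frequency.
\<close>

definition glue_pair :: "'n set \<Rightarrow> (('n \<Rightarrow> real) \<times> ('n \<Rightarrow> real)) \<Rightarrow> (('n \<Rightarrow> real) \<times> ('n \<Rightarrow> real)) \<Rightarrow> real ^ ('n::finite + 'n)" where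
  "glue_pair K z z' = (\<chi> j. case j of Inl i \<Rightarrow> glue K (fst z) (fst z') $ i | Inr i \<Rightarrow> glue K (snd z) (snd z') $ i)"

lemma measurable_glue [measurable (raw)]:
  assumes [measurable]: "h1 \<in> measurable N (lborel_on K)" "h2 \<in> measurable N (lborel_on (- K))"
  shows "(\<lambda>z. glue K (h1 z) (h2 z)) \<in> borel_measurable N"
    and "(\<lambda>z. glue K (h1 z) (\<lambda>i. - h2 z i)) \<in> borel_measurable N"
proof -
  have [measurable]: "(\<lambda>z. if i \<in> K then h1 z i else h2 z i) \<in> borel_measurable N"
    "(\<lambda>z. if i \<in> K then h1 z i else - h2 z i) \<in> borel_measurable N" for i
    by (cases "i \<in> K"; simp)+
  show "(\<lambda>z. glue K (h1 z) (h2 z)) \<in> borel_measurable N"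
    and "(\<lambda>z. glue K (h1 z) (\<lambda>i. - h2 z i)) \<in> borel_measurable N"
    unfolding glue_def by measurable
qed

lemma measurable_glue_pair [measurable (raw)]:
  fixes K :: "'n::finite set"
  assumes [measurable]: "h1 \<in> measurable N (lborel_on K \<Otimes>\<^sub>M lborel_on K)" "h2 \<in> measurable N (lborel_on (- K) \<Otimes>\<^sub>M lborel_on (- K))"
  shows "(\<lambda>z. glue_pair K (h1 z) (h2 z)) \<in> borel_measurable N"
  unfolding glue_pair_def
proof (rule borel_measurable_vec_lambda)
  fix j :: "'n + 'n"
  show "(\<lambda>z. case j of Inl i \<Rightarrow> glue K (fst (h1 z)) (fst (h2 z)) $ i | Inr i \<Rightarrow> glue K (snd (h1 z)) (snd (h2 z)) $ i) \<in> borel_measurable N"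
    by (cases j) (simp_all, measurable)
qed

lemma emeasure_lborel_on_box:
  assumes "finite K" "\<And>i. i \<in> K \<Longrightarrow> l i \<le> u i"
  shows "emeasure (lborel_on K) (PiE K (\<lambda>i. {l i <..< u i})) = (\<Prod>i\<in>K. ennreal (u i - l i))"
  using assms by (subst lebesgue_product.emeasure_PiM) auto

lemma prod_split_compl:
  fixes F :: "'n::finite \<Rightarrow> 'b::comm_monoid_mult"
  shows "prod F UNIV = prod F K * prod F (- K)"
  by (subst prod.union_disjoint[symmetric]) auto

lemma distr_glue:
  "distr (lborel_on K \<Otimes>\<^sub>M lborel_on (- K)) borel (\<lambda>z. glue K (fst z) (snd z)) = (lborel :: (real ^ 'n::finite) measure)"
proof (rule distr_eq_lborel_cartI)
  interpret A: sigma_finite_measure "lborel_on (- K)" by (rule sigma_finite_lborel_on) simp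
  fix l u :: "real ^ 'n" assume le: "\<And>i. l $ i \<le> u $ i"
  let ?P = "\<lambda>K. PiE K (\<lambda>i. {l $ i <..< u $ i})"
  have "{z \<in> space (lborel_on K \<Otimes>\<^sub>M lborel_on (- K)). \<forall>i. glue K (fst z) (snd z) $ i \<in> {l $ i <..< u $ i}} = ?P K \<times> ?P (- K)"
    by (auto simp: space_pair_measure space_PiM PiE_iff glue_def split: if_splits) 
  moreover have "?P K \<in> sets (lborel_on K)" for K :: "'n set" by (intro sets_PiM_I_finite) auto
  ultimately show "emeasure (lborel_on K \<Otimes>\<^sub>M lborel_on (- K)) {z \<in> space (lborel_on K \<Otimes>\<^sub>M lborel_on (- K)). \<forall>i. glue K (fst z) (snd z) $ i \<in> {l $ i <..< u $ i}} = (\<Prod>i\<in>UNIV. ennreal (u $ i - l $ i))"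
    using le by (simp add: A.emeasure_pair_measure_Times emeasure_lborel_on_box prod_split_compl[of _ K])
qed measurable

lemma distr_glue_pair:
  "distr ((lborel_on K \<Otimes>\<^sub>M lborel_on K) \<Otimes>\<^sub>M (lborel_on (- K) \<Otimes>\<^sub>M lborel_on (- K))) borel (\<lambda>z. glue_pair K (fst z) (snd z))
    = (lborel :: (real ^ ('n::finite + 'n)) measure)"
proof (rule distr_eq_lborel_cartI)
  interpret A: sigma_finite_measure "lborel_on K" by (rule sigma_finite_lborel_on) simp
  interpret B: sigma_finite_measure "lborel_on (- K)" by (rule sigma_finite_lborel_on) simp
  interpret BB: pair_sigma_finite "lborel_on (- K)" "lborel_on (- K)" ..
  let ?M = "(lborel_on K \<Otimes>\<^sub>M lborel_on K) \<Otimes>\<^sub>M (lborel_on (- K) \<Otimes>\<^sub>M lborel_on (- K))"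
  fix l u :: "real ^ ('n + 'n)" assume le: "\<And>i. l $ i \<le> u $ i"
  let ?P = "\<lambda>c K. PiE K (\<lambda>i. {l $ c i <..< u $ c i})"
  have ex: "{z \<in> space ?M. \<forall>j. glue_pair K (fst z) (snd z) $ j \<in> {l $ j <..< u $ j}} = (?P Inl K \<times> ?P Inr K) \<times> (?P Inl (- K) \<times> ?P Inr (- K))"
    (is "?L = ?R")
  proof (rule set_eqI)
    fix z :: "(('n \<Rightarrow> real) \<times> ('n \<Rightarrow> real)) \<times> (('n \<Rightarrow> real) \<times> ('n \<Rightarrow> real))"
    have "(\<forall>j. glue_pair K (fst z) (snd z) $ j \<in> {l $ j <..< u $ j})
      \<longleftrightarrow> (\<forall>i. glue K (fst (fst z)) (fst (snd z)) $ i \<in> {l $ Inl i <..< u $ Inl i})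
        \<and> (\<forall>i. glue K (snd (fst z)) (snd (snd z)) $ i \<in> {l $ Inr i <..< u $ Inr i})"
      unfolding glue_pair_def by (simp add: split_sum_all)
    then show "z \<in> ?L \<longleftrightarrow> z \<in> ?R"
      by (cases z) (auto simp: space_pair_measure space_PiM PiE_iff glue_def split: if_splits)
  qed
  have P: "?P c K \<in> sets (lborel_on K)" for c and K :: "'n set" by (intro sets_PiM_I_finite) auto
  have "(\<Prod>j\<in>UNIV. ennreal (u $ j - l $ j)) = (\<Prod>i\<in>UNIV. ennreal (u $ Inl i - l $ Inl i)) * (\<Prod>i\<in>UNIV. ennreal (u $ Inr i - l $ Inr i))"
    by (subst UNIV_Plus_UNIV [symmetric], subst prod.Plus) auto
  then show "emeasure ?M {z \<in> space ?M. \<forall>j. glue_pair K (fst z) (snd z) $ j \<in> {l $ j <..< u $ j}} = (\<Prod>j\<in>UNIV. ennreal (u $ j - l $ j))"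
    unfolding ex using le P
    by (simp add: BB.P.emeasure_pair_measure_Times B.emeasure_pair_measure_Times A.emeasure_pair_measure_Times emeasure_lborel_on_box
        prod_split_compl[of "\<lambda>i. ennreal (u $ Inl i - l $ Inl i)" K] prod_split_compl[of "\<lambda>i. ennreal (u $ Inr i - l $ Inr i)" K] mult_ac)
qed measurable

lemma nn_integral_glue:
  fixes h :: "real ^ 'n::finite \<Rightarrow> ennreal"
  assumes [measurable]: "h \<in> borel_measurable borel"
  shows "(\<integral>\<^sup>+ x. h x \<partial>lborel) = (\<integral>\<^sup>+ y. \<integral>\<^sup>+ t. h (glue K t y) \<partial>lborel_on K \<partial>lborel_on (- K))"
proof -
  interpret A: sigma_finite_measure "lborel_on K" by (rule sigma_finite_lborel_on) simp
  interpret B: sigma_finite_measure "lborel_on (- K)" by (rule sigma_finite_lborel_on) simp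
  interpret AB: pair_sigma_finite "lborel_on K" "lborel_on (- K)" ..
  have "(\<integral>\<^sup>+ x. h x \<partial>lborel) = (\<integral>\<^sup>+ z. h (glue K (fst z) (snd z)) \<partial>(lborel_on K \<Otimes>\<^sub>M lborel_on (- K)))"
    by (subst distr_glue[of K, symmetric], subst nn_integral_distr) auto
  also have "\<dots> = (\<integral>\<^sup>+ y. \<integral>\<^sup>+ t. h (glue K t y) \<partial>lborel_on K \<partial>lborel_on (- K))"
    by (subst AB.nn_integral_snd[symmetric]) auto
  finally show ?thesis .
qed

text \<open>
  The reflected form is needed because the window enters the partial transform at \<open>- \<omega>\<^sub>2\<close>.
\<close>

lemma nn_integral_glue_reflect:
  fixes h :: "real ^ 'n::finite \<Rightarrow> ennreal"
  assumes [measurable]: "h \<in> borel_measurable borel"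
  shows "(\<integral>\<^sup>+ x. h x \<partial>lborel) = (\<integral>\<^sup>+ y. \<integral>\<^sup>+ t. h (glue K t (\<lambda>i. - y i)) \<partial>lborel_on K \<partial>lborel_on (- K))"
proof -
  interpret A: sigma_finite_measure "lborel_on K" by (rule sigma_finite_lborel_on) simp
  have "(\<integral>\<^sup>+ x. h x \<partial>lborel) = (\<integral>\<^sup>+ y. \<integral>\<^sup>+ t. h (glue K t y) \<partial>lborel_on K \<partial>distr (lborel_on (- K)) (lborel_on (- K)) (\<lambda>t. \<lambda>i\<in>-K. 0 - t i))"
    by (subst distr_lborel_on_reflect_translate) (simp_all add: nn_integral_glue[of h K])
  also have "\<dots> = (\<integral>\<^sup>+ y. \<integral>\<^sup>+ t. h (glue K t (\<lambda>i\<in>-K. 0 - y i)) \<partial>lborel_on K \<partial>lborel_on (- K))"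
    by (subst nn_integral_distr) measurable
  also have "\<dots> = (\<integral>\<^sup>+ y. \<integral>\<^sup>+ t. h (glue K t (\<lambda>i. - y i)) \<partial>lborel_on K \<partial>lborel_on (- K))"
  proof -
    have "glue K t (\<lambda>i\<in>-K. 0 - y i) = glue K t (\<lambda>i. - y i)" for t y
      by (simp add: glue_def vec_eq_iff)
    then show ?thesis by simp
  qed
  finally show ?thesis .
qed

section \<open>The partial short-time Fourier transform\<close>

lemma inner_half_halves:
  fixes z :: "real ^ ('n::finite + 'n)"
  shows "z \<bullet> (block_mat 0 (mat 1) (mat 1) 0 *v z) = 2 * (fst_half z \<bullet> snd_half z)"
proof -
  have sum_split: "sum h UNIV = (\<Sum>i\<in>UNIV. h (Inl i)) + (\<Sum>i\<in>UNIV. h (Inr i))" for h :: "'n + 'n \<Rightarrow> real"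
    by (subst UNIV_Plus_UNIV [symmetric], subst sum.Plus) auto
  have "(block_mat 0 (mat 1) (mat 1) 0 *v z) $ Inl i = z $ Inr i" "(block_mat 0 (mat 1) (mat 1) 0 *v z) $ Inr i = z $ Inl i" for i
    by (simp_all add: matrix_vector_mult_def block_mat_def sum_split mat_def if_distrib[where f = "\<lambda>x. x * _"] cong: if_cong)
  then show ?thesis
    by (simp add: inner_vec_def sum_split fst_half_def snd_half_def mult.commute)
qed

lemma borel_measurable_halves [measurable]:
  "fst_half \<in> borel_measurable (borel :: (real ^ ('n::finite + 'n)) measure)"
  "snd_half \<in> borel_measurable (borel :: (real ^ ('n::finite + 'n)) measure)"
  unfolding fst_half_def[abs_def] snd_half_def[abs_def] by measurable

lemma halves_glue_pair:
  "fst_half (glue_pair K z z') = glue K (fst z) (fst z')"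
  "snd_half (glue_pair K z z') = glue K (snd z) (snd z')"
  by (simp_all add: fst_half_def snd_half_def glue_pair_def vec_eq_iff)

lemma partial_STFT_measurable:
  fixes f g :: "real ^ 'd::{finite,linorder} \<Rightarrow> complex"
  assumes [measurable]: "f \<in> borel_measurable borel" "g \<in> borel_measurable borel"
  shows "partial_STFT k g f \<in> borel_measurable borel"
proof -
  define K where "K = (first_coords k :: 'd set)"
  interpret sigma_finite_measure "lborel_on K" by (rule sigma_finite_lborel_on) simp
  have [measurable]: "(\<lambda>z. \<chi> i. if i \<in> K then snd z i else fst_half (fst z) $ i) \<in> borel_measurable (borel \<Otimes>\<^sub>M lborel_on K)"
  proof (rule borel_measurable_vec_lambda)
    fix i :: 'd
    show "(\<lambda>z. if i \<in> K then snd z i else fst_half (fst z) $ i) \<in> borel_measurable (borel \<Otimes>\<^sub>M lborel_on K)"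
      by (cases "i \<in> K") (simp_all, measurable)
  qed
  have [measurable]: "(\<lambda>z. \<chi> i. if i \<in> K then snd z i - fst_half (fst z) $ i else - snd_half (fst z) $ i) \<in> borel_measurable (borel \<Otimes>\<^sub>M lborel_on K)"
  proof (rule borel_measurable_vec_lambda)
    fix i :: 'd
    show "(\<lambda>z. if i \<in> K then snd z i - fst_half (fst z) $ i else - snd_half (fst z) $ i) \<in> borel_measurable (borel \<Otimes>\<^sub>M lborel_on K)"
      by (cases "i \<in> K") (simp_all, measurable)
  qed
  show ?thesis
    unfolding partial_STFT_def[abs_def] Let_def cis_conv_exp K_def[symmetric]
    by (rule borel_measurable_lebesgue_integral) (simp add: case_prod_beta')
qed

lemma partial_STFT_glue_pair:
  fixes f g :: "real ^ 'd::{finite,linorder} \<Rightarrow> complex" and k :: nat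
  defines "K \<equiv> first_coords k :: 'd set"
  shows "partial_STFT k g f (glue_pair K z z')
    = STFT_on K (\<lambda>s. g (glue K s (\<lambda>i. - snd z' i))) (\<lambda>t. f (glue K t (fst z'))) (fst z) (snd z)"
proof -
  have 1: "(\<chi> i. if i \<in> K then t i else glue K (fst z) (fst z') $ i) = glue K t (fst z')" for t
    by (simp add: glue_def vec_eq_iff)
  have 2: "(\<chi> i. if i \<in> K then t i - glue K (fst z) (fst z') $ i else - glue K (snd z) (snd z') $ i)
      = glue K (\<lambda>i\<in>K. t i - fst z i) (\<lambda>i. - snd z' i)" for t
    by (simp add: glue_def vec_eq_iff)
  have 3: "(\<Sum>i\<in>K. t i * glue K (snd z) (snd z') $ i) = (\<Sum>i\<in>K. t i * snd z i)" for t
    by (intro sum.cong) (auto simp: glue_def)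
  show ?thesis
    unfolding partial_STFT_def STFT_on_def Let_def K_def[symmetric] halves_glue_pair 1 2 3 ..
qed

lemma AE_square_integrable_slice:
  fixes f :: "real ^ 'n::finite \<Rightarrow> complex"
  assumes "f \<in> L2"
  shows "AE y in lborel_on (- K). square_integrable_on K (\<lambda>t. f (glue K t y))"
    and "AE y in lborel_on (- K). square_integrable_on K (\<lambda>t. f (glue K t (\<lambda>i. - y i)))"
proof -
  interpret A: sigma_finite_measure "lborel_on K" by (rule sigma_finite_lborel_on) simp
  have [measurable]: "f \<in> borel_measurable borel" and f2: "integrable lborel (\<lambda>x. (norm (f x))\<^sup>2)"
    using assms by (auto simp: L2_def)
  have fin: "(\<integral>\<^sup>+ x. (norm (f x))\<^sup>2 \<partial>lborel) < \<infinity>"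
    using f2 by (simp add: integrable_iff_bounded)
  have sq: "square_integrable_on K h" if "h \<in> borel_measurable (lborel_on K)" "(\<integral>\<^sup>+ t. (norm (h t))\<^sup>2 \<partial>lborel_on K) \<noteq> \<infinity>" for h
    using that unfolding square_integrable_on_def by (auto simp: integrable_iff_bounded top.not_eq_extremum)
  have "AE y in lborel_on (- K). (\<integral>\<^sup>+ t. (norm (f (glue K t y)))\<^sup>2 \<partial>lborel_on K) \<noteq> \<infinity>"
    using fin by (intro nn_integral_noteq_infinite) (auto simp: nn_integral_glue[of _ K])
  then show "AE y in lborel_on (- K). square_integrable_on K (\<lambda>t. f (glue K t y))"
    using AE_space by eventually_elim (intro sq, measurable)
  have "AE y in lborel_on (- K). (\<integral>\<^sup>+ t. (norm (f (glue K t (\<lambda>i. - y i))))\<^sup>2 \<partial>lborel_on K) \<noteq> \<infinity>"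
    using fin by (intro nn_integral_noteq_infinite) (auto simp: nn_integral_glue_reflect[of _ K])
  then show "AE y in lborel_on (- K). square_integrable_on K (\<lambda>t. f (glue K t (\<lambda>i. - y i)))"
    using AE_space by eventually_elim (intro sq, measurable)
qed

lemma AE_zero_from_slices:
  fixes f :: "real ^ 'n::finite \<Rightarrow> complex"
  assumes [measurable]: "f \<in> borel_measurable borel"
    and "(AE y in lborel_on (- K). AE t in lborel_on K. f (glue K t y) = 0)
      \<or> (AE y in lborel_on (- K). AE t in lborel_on K. f (glue K t (\<lambda>i. - y i)) = 0)"
  shows "AE x in lborel. f x = 0"
proof -
  have zero: "(\<integral>\<^sup>+ y. \<integral>\<^sup>+ t. norm (f (e t y)) \<partial>lborel_on K \<partial>lborel_on (- K)) = 0"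
    if "AE y in lborel_on (- K). AE t in lborel_on K. f (e t y) = 0" for e
  proof -
    have "(\<integral>\<^sup>+ y. \<integral>\<^sup>+ t. norm (f (e t y)) \<partial>lborel_on K \<partial>lborel_on (- K)) = (\<integral>\<^sup>+ y. 0 \<partial>lborel_on (- K))"
      using that
    proof (intro nn_integral_cong_AE, eventually_elim)
      case (elim y)
      then have "(\<integral>\<^sup>+ t. norm (f (e t y)) \<partial>lborel_on K) = (\<integral>\<^sup>+ t. 0 \<partial>lborel_on K)"
        by (intro nn_integral_cong_AE) (auto elim!: eventually_mono)
      then show ?case by simp
    qed
    then show ?thesis by simp
  qed
  have "(\<integral>\<^sup>+ x. norm (f x) \<partial>lborel) = 0"
    using assms(2)
  proof
    assume "AE y in lborel_on (- K). AE t in lborel_on K. f (glue K t y) = 0"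
    from zero[OF this] show ?thesis by (subst nn_integral_glue[of _ K]) auto
  next
    assume "AE y in lborel_on (- K). AE t in lborel_on K. f (glue K t (\<lambda>i. - y i)) = 0"
    from zero[OF this] show ?thesis by (subst nn_integral_glue_reflect[of _ K]) auto
  qed
  then show ?thesis by (subst (asm) nn_integral_0_iff_AE) auto
qed

text \<open>
  For almost all values of the coordinates outside \<open>K\<close> the partial transform is a short-time Fourier transform of
  slices of \<open>f\<close> and \<open>g\<close>, and the weight dominates that of Beurling's condition in the coordinates of \<open>K\<close> up to a
  constant depending on the slice. So for almost every pair of slices one of the two vanishes. The slice of \<open>f\<close>
  depends on the position only and that of \<open>g\<close> on the frequency only, hence either almost all slices of \<open>f\<close> or
  almost all slices of \<open>g\<close> vanish.
\<close>

theorem Beurling_partial_STFT: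
  fixes f g :: "real ^ 'd::{finite,linorder} \<Rightarrow> complex"
  assumes k: "1 \<le> k" and f: "f \<in> L2" and g: "g \<in> L2"
    and fin: "(\<integral>\<^sup>+ z. ennreal (norm (partial_STFT k g f z) * exp (pi * \<bar>fst_half z \<bullet> snd_half z\<bar>)) \<partial>lborel) < \<infinity>"
  shows "f \<approx> (\<lambda>_. 0) \<or> g \<approx> (\<lambda>_. 0)"
proof -
  define K where "K = (first_coords k :: 'd set)"
  obtain m :: 'd where "\<And>j. m \<le> j" using Min_le[of UNIV] by (metis UNIV_I finite_class.finite_UNIV)
  then have "{j. j < m} = {}" by (auto simp: not_less)
  then have "m \<in> K" using k by (simp add: K_def first_coords_def)
  then have K: "K \<noteq> {}" by auto
  have [measurable]: "f \<in> borel_measurable borel" "g \<in> borel_measurable borel"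
    using f g by (auto simp: L2_def)
  note [measurable] = partial_STFT_measurable[of f g k]
  define h where "h z = norm (partial_STFT k g f z) * exp (pi * \<bar>fst_half z \<bullet> snd_half z\<bar>)" for z
  have [measurable]: "h \<in> borel_measurable borel"
    unfolding h_def[abs_def] by measurable
  let ?M = "lborel_on K" and ?N = "lborel_on (- K)"
  interpret M: sigma_finite_measure ?M by (rule sigma_finite_lborel_on) simp
  interpret N: sigma_finite_measure ?N by (rule sigma_finite_lborel_on) simp
  interpret MM: pair_sigma_finite ?M ?M ..
  interpret NN: pair_sigma_finite ?N ?N ..
  interpret P: pair_sigma_finite "?M \<Otimes>\<^sub>M ?M" "?N \<Otimes>\<^sub>M ?N" ..
  have "(\<integral>\<^sup>+ z'. \<integral>\<^sup>+ z. h (glue_pair K z z') \<partial>(?M \<Otimes>\<^sub>M ?M) \<partial>(?N \<Otimes>\<^sub>M ?N))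
      = (\<integral>\<^sup>+ y. h (glue_pair K (fst y) (snd y)) \<partial>((?M \<Otimes>\<^sub>M ?M) \<Otimes>\<^sub>M (?N \<Otimes>\<^sub>M ?N)))"
    by (subst P.nn_integral_snd[symmetric]) auto
  also have "\<dots> = (\<integral>\<^sup>+ z. h z \<partial>distr ((?M \<Otimes>\<^sub>M ?M) \<Otimes>\<^sub>M (?N \<Otimes>\<^sub>M ?N)) borel (\<lambda>y. glue_pair K (fst y) (snd y)))"
    by (subst nn_integral_distr) auto
  also have "\<dots> = (\<integral>\<^sup>+ z. h z \<partial>lborel)" by (simp only: distr_glue_pair)
  also have "\<dots> < \<infinity>" using fin by (simp add: h_def)
  finally have "AE z' in ?N \<Otimes>\<^sub>M ?N. (\<integral>\<^sup>+ z. h (glue_pair K z z') \<partial>(?M \<Otimes>\<^sub>M ?M)) \<noteq> \<infinity>"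
    by (intro nn_integral_noteq_infinite) auto
  from NN.AE_pair[OF this]
  have AE_h: "AE y in ?N. AE v in ?N. (\<integral>\<^sup>+ z. h (glue_pair K z (y, v)) \<partial>(?M \<Otimes>\<^sub>M ?M)) \<noteq> \<infinity>" .

  let ?f = "\<lambda>y t. f (glue K t y)" and ?g = "\<lambda>v t. g (glue K t (\<lambda>i. - v i))"
  have slice: "(AE t in ?M. ?f y t = 0) \<or> (AE t in ?M. ?g v t = 0)"
    if y: "y \<in> space ?N" "square_integrable_on K (?f y)" and v: "v \<in> space ?N" "square_integrable_on K (?g v)"
      and hfin: "(\<integral>\<^sup>+ z. h (glue_pair K z (y, v)) \<partial>(?M \<Otimes>\<^sub>M ?M)) \<noteq> \<infinity>" for y v
  proof (rule Beurling_STFT[OF _ K y(2) v(2)])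
    define c where "c = (\<Sum>i\<in>-K. y i * v i)"
    define D where "D z = norm (STFT_on K (?g v) (?f y) (fst z) (snd z)) * exp (pi * \<bar>\<Sum>i\<in>K. fst z i * snd z i\<bar>)" for z
    have [measurable]: "?f y \<in> borel_measurable ?M" "?g v \<in> borel_measurable ?M"
      using y v by (auto simp: square_integrable_on_def)
    have D_meas: "D \<in> borel_measurable (?M \<Otimes>\<^sub>M ?M)"
    proof -
      note [measurable] = measurable_STFT_on[of K "?f y" "?g v"]
      show ?thesis unfolding D_def[abs_def] by measurable
    qed
    have D_le: "D z \<le> exp (pi * \<bar>c\<bar>) * h (glue_pair K z (y, v))" for z
    proof -
      have "fst_half (glue_pair K z (y, v)) \<bullet> snd_half (glue_pair K z (y, v))
          = (\<Sum>i\<in>UNIV. glue K (fst z) y $ i * glue K (snd z) v $ i)"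
        by (simp add: halves_glue_pair inner_vec_def)
      also have "\<dots> = (\<Sum>i\<in>K. glue K (fst z) y $ i * glue K (snd z) v $ i) + (\<Sum>i\<in>-K. glue K (fst z) y $ i * glue K (snd z) v $ i)"
        by (subst sum.union_disjoint[symmetric]) auto
      also have "\<dots> = (\<Sum>i\<in>K. fst z i * snd z i) + c"
        unfolding c_def by (intro arg_cong2[where f = "(+)"] sum.cong) (auto simp: glue_def)
      finally have "\<bar>\<Sum>i\<in>K. fst z i * snd z i\<bar> \<le> \<bar>c\<bar> + \<bar>fst_half (glue_pair K z (y, v)) \<bullet> snd_half (glue_pair K z (y, v))\<bar>"
        by linarith
      then have "exp (pi * \<bar>\<Sum>i\<in>K. fst z i * snd z i\<bar>) \<le> exp (pi * \<bar>c\<bar>) * exp (pi * \<bar>fst_half (glue_pair K z (y, v)) \<bullet> snd_half (glue_pair K z (y, v))\<bar>)"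
        by (simp add: exp_add[symmetric] distrib_left[symmetric])
      then show ?thesis
        unfolding D_def h_def partial_STFT_glue_pair[of k g f z "(y, v)", folded K_def] fst_conv snd_conv
        by (subst mult.left_commute) (rule mult_left_mono, simp_all)
    qed
    have "(\<integral>\<^sup>+ z. D z \<partial>(?M \<Otimes>\<^sub>M ?M)) \<le> (\<integral>\<^sup>+ z. ennreal (exp (pi * \<bar>c\<bar>)) * ennreal (h (glue_pair K z (y, v))) \<partial>(?M \<Otimes>\<^sub>M ?M))"
      using D_le by (intro nn_integral_mono) (simp add: ennreal_mult'[symmetric] ennreal_leI)
    also have "\<dots> = ennreal (exp (pi * \<bar>c\<bar>)) * (\<integral>\<^sup>+ z. h (glue_pair K z (y, v)) \<partial>(?M \<Otimes>\<^sub>M ?M))"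
      using y(1) v(1) by (intro nn_integral_cmult) (auto simp: space_pair_measure)
    also have "\<dots> < \<infinity>"
      using hfin by (simp add: ennreal_mult_less_top top.not_eq_extremum)
    finally show "integrable (?M \<Otimes>\<^sub>M ?M) (\<lambda>z. norm (STFT_on K (?g v) (?f y) (fst z) (snd z)) * exp (pi * \<bar>\<Sum>i\<in>K. fst z i * snd z i\<bar>))"
      using D_meas unfolding integrable_iff_bounded D_def[symmetric] by (simp add: D_def)
  qed simp
  have key: "AE y in ?N. AE v in ?N. (AE t in ?M. ?f y t = 0) \<or> (AE t in ?M. ?g v t = 0)"
    using AE_h AE_square_integrable_slice(1)[OF f] AE_space
  proof eventually_elim
    case y: (elim y)
    show ?case
      using y(1) AE_square_integrable_slice(2)[OF g] AE_space
      by eventually_elim (rule slice[OF y(3,2)])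
  qed
  show ?thesis
  proof (cases "AE v in ?N. AE t in ?M. ?g v t = 0")
    case True
    then have "AE x in lborel. g x = 0" by (intro AE_zero_from_slices[where K = K]) auto
    then show ?thesis by (simp add: ae_eq_def)
  next
    case False
    have "AE y in ?N. AE t in ?M. ?f y t = 0"
      using key
    proof eventually_elim
      case (elim y)
      then show ?case using False by (cases "AE t in ?M. ?f y t = 0") auto
    qed
    then have "AE x in lborel. f x = 0" by (intro AE_zero_from_slices[where K = K]) auto
    then show ?thesis by (simp add: ae_eq_def)
  qed
qed

lemma unitary_operator_zero:
  assumes T: "unitary_operator T" and f: "f \<in> L2" and zero: "T f \<approx> (\<lambda>_. 0)"
  shows "f \<approx> (\<lambda>_. 0)"
proof -
  have [measurable]: "f \<in> borel_measurable lborel" and f2: "integrable lborel (\<lambda>x. (norm (f x))\<^sup>2)"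
    using f by (auto simp: L2_def)
  have "of_real (LINT x|lborel. (norm (f x))\<^sup>2) = L2_inner f f"
    unfolding L2_inner_def complex_norm_square[symmetric] by (rule integral_complex_of_real[symmetric])
  also have "\<dots> = L2_inner (T f) (T f)"
    using T f by (simp add: unitary_operator_def)
  also have "\<dots> = 0"
    unfolding L2_inner_def using zero unfolding ae_eq_def
    by (intro integral_eq_zero_AE) (auto elim!: eventually_mono)
  finally have "AE x in lborel. (norm (f x))\<^sup>2 = 0"
    by (subst integral_nonneg_eq_0_iff_AE[OF f2, symmetric]) auto
  then show ?thesis unfolding ae_eq_def by simp
qed

text \<open>
  The factorisation moves the hypothesis to the partial short-time Fourier transform of the images of \<open>f\<close> and \<open>g\<close> under unitary
  operators; the coordinate change by \<open>\<Omega>\<close> turns the quadratic form in the weight into \<open>2 x \<bullet> \<omega>\<close>.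
\<close>

theorem theorem4p4:
  fixes U :: "complex ^ ('d::{finite,linorder} + 'd) ^ ('d + 'd)"
    and A_op :: "(real ^ ('d + 'd) \<Rightarrow> complex) \<Rightarrow> (real ^ ('d + 'd) \<Rightarrow> complex)"
    and \<Omega> :: "real ^ ('d + 'd) ^ ('d + 'd)"
    and k :: nat
    and \<A> \<B> :: "real ^ ('d + 'd) ^ ('d + 'd)"
    and \<A>_op \<B>_op :: "(real ^ 'd::{finite,linorder} \<Rightarrow> complex) \<Rightarrow> (real ^ 'd::{finite,linorder} \<Rightarrow> complex)"
    and f g :: "real ^ 'd::{finite,linorder} \<Rightarrow> complex"
  assumes "unitary_matrix U"
    and "\<not> block_diagonal (transpose U ** U)"
    and "metaplectic (rot_mat U) A_op"
    and "invertible \<Omega>"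
    and "1 \<le> k" and "k \<le> CARD('d)"
    and "\<A> \<in> Sp" and "\<B> \<in> Sp"
    and "metaplectic \<A> \<A>_op" and "metaplectic \<B> \<B>_op"
    and "\<And>u v. u \<in> L2 \<Longrightarrow> v \<in> L2 \<Longrightarrow>
           AE l in lborel. norm (metaplectic_tfr A_op u v l)
             = norm (dilation \<Omega> (partial_STFT k (\<B>_op v) (\<A>_op u)) l)"
    and "f \<in> L2" and "g \<in> L2"
    and "(\<integral>\<^sup>+ l. ennreal (norm (metaplectic_tfr A_op f g l)
            * exp (pi / 2 * \<bar>(matrix_inv \<Omega> *v l)
                \<bullet> (block_mat 0 (mat 1) (mat 1) 0 *v (matrix_inv \<Omega> *v l))\<bar>)) \<partial>lborel) < \<infinity>"
  shows "f \<approx> (\<lambda>_. 0) \<or> g \<approx> (\<lambda>_. 0)"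
proof -
  have uA: "unitary_operator \<A>_op" and uB: "unitary_operator \<B>_op"
    using assms(9,10) by (auto simp: metaplectic_def)
  have Af: "\<A>_op f \<in> L2" and Bg: "\<B>_op g \<in> L2"
    using uA uB assms(12,13) by (auto simp: unitary_operator_def)
  then have [measurable]: "\<A>_op f \<in> borel_measurable borel" "\<B>_op g \<in> borel_measurable borel"
    by (auto simp: L2_def)
  note [measurable] = partial_STFT_measurable[of "\<A>_op f" "\<B>_op g" k]
  define h where "h z = norm (partial_STFT k (\<B>_op g) (\<A>_op f) z) * exp (pi * \<bar>fst_half z \<bullet> snd_half z\<bar>)" for z
  have [measurable]: "h \<in> borel_measurable borel"
    unfolding h_def[abs_def] by measurable
  have [measurable]: "(\<lambda>l. matrix_inv \<Omega> *v l) \<in> borel_measurable borel"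
    by (intro borel_measurable_continuous_onI linear_continuous_on)
      (simp add: matrix_vector_mul_bounded_linear)
  have inv: "\<Omega> ** matrix_inv \<Omega> = mat 1" "matrix_inv \<Omega> ** \<Omega> = mat 1"
    using someI_ex[OF assms(4)[unfolded invertible_def]] by (auto simp: matrix_inv_def)
  have "det \<Omega> \<noteq> 0" using assms(4) by (simp add: invertible_det_nz)
  define c where "c = \<bar>det \<Omega>\<bar> powr (- 1 / 2)"
  have c: "c > 0" using \<open>det \<Omega> \<noteq> 0\<close> by (simp add: c_def)
  have "(\<integral>\<^sup>+ l. ennreal c * ennreal (h (matrix_inv \<Omega> *v l)) \<partial>lborel) = (\<integral>\<^sup>+ l. ennreal (norm (metaplectic_tfr A_op f g l)
            * exp (pi / 2 * \<bar>(matrix_inv \<Omega> *v l)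
                \<bullet> (block_mat 0 (mat 1) (mat 1) 0 *v (matrix_inv \<Omega> *v l))\<bar>)) \<partial>lborel)"
  proof (rule nn_integral_cong_AE, use assms(11)[OF assms(12,13)] in eventually_elim)
    case (elim l)
    have "norm (dilation \<Omega> (partial_STFT k (\<B>_op g) (\<A>_op f)) l) = c * norm (partial_STFT k (\<B>_op g) (\<A>_op f) (matrix_inv \<Omega> *v l))"
      using c by (simp add: dilation_def norm_mult c_def)
    then show ?case
      unfolding elim inner_half_halves h_def using c by (simp add: ennreal_mult'[symmetric] abs_mult mult.assoc)
  qed
  also have "\<dots> < \<infinity>" by (rule assms(14))
  finally have "ennreal c * (\<integral>\<^sup>+ l. h (matrix_inv \<Omega> *v l) \<partial>lborel) < \<infinity>"
    by (subst nn_integral_cmult[symmetric]) auto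
  then have "(\<integral>\<^sup>+ l. h (matrix_inv \<Omega> *v l) \<partial>lborel) < \<infinity>"
    using c by (auto simp: ennreal_mult_less_top)
  then have "(\<integral>\<^sup>+ z. h z \<partial>lborel) < \<infinity>"
    by (rule nn_integral_linear_finite[where S = "(*v) \<Omega>", rotated 3])
      (simp_all add: matrix_vector_mul_assoc inv matrix_vector_mul_linear)
  then have "\<A>_op f \<approx> (\<lambda>_. 0) \<or> \<B>_op g \<approx> (\<lambda>_. 0)"
    unfolding h_def by (rule Beurling_partial_STFT[OF assms(5) Af Bg])
  then show ?thesis
    using unitary_operator_zero[OF uA assms(12)] unitary_operator_zero[OF uB assms(13)] by blast
qed

end
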